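(* Let $\varphi$ be a minimal counterexample to Vaught's conjecture and let $\lambda\in S^\circ=\mathfrak F\cap C_{5.3}\cap(\mathrm{qr}(\varphi),\omega_1)$. Let $M,M'$ be fiber models at $\lambda$, let $q$ be an $n$-type of $T_\lambda$ realized in both $M$ and $M'$, and put $\Gamma:=\Phi_M(q)$. If $\Gamma$ is $\Sigma^{\mathrm{in}}_\lambda$-supported within $M$ by a formula $\theta$, then $\Phi_{M'}(q)=\Gamma$, and the same $\theta$ supports $\Gamma$ within $M'$.
   Context: Structures are countable structures in a countable vocabulary; classes of models are counted up to isomorphism. $\Sigma^{\mathrm{in}}_0=\Pi^{\mathrm{in}}_0$ is the set of finitary quantifier-free formulas; for $\alpha>0$, $\Sigma^{\mathrm{in}}_\alpha$ consists of countable disjunctions of formulas $\exists\bar x\,\psi$ with $\psi\in\Pi^{\mathrm{in}}_\beta$, $\beta<\alpha$, and $\Pi^{\mathrm{in}}_\alpha$ is dual. $M\equiv_\alpha N$: $M,N$ satisfy the same $\Pi^{\mathrm{in}}_\alpha$ (equivalently $\Sigma^{\mathrm{in}}_\alpha$) sentences. A Scott sentence of $M$ is an $L_{\omega_1\omega}$ sentence whose countable models are exactly the copies of $M$. $\mathrm{cSR}(M)$: the least $\alpha$ such that $M$ has a $\Pi^{\mathrm{in}}_{\alpha+1}$ Scott sentence. $\omega_1^A=\min\{\omega_1^X: X\in 2^\omega\text{ computes a copy of }A\}$. $\mathrm{qr}(S)$: the least $\beta$ with $S\in\Pi^{\mathrm{in}}_\beta\cup\Sigma^{\mathrm{in}}_\beta$.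 Standing hypotheses: Vaught's conjecture fails, and $\varphi$ is a minimal counterexample: an $L_{\omega_1\omega}$ sentence with exactly $\aleph_1$ countable models up to isomorphism, scattered (for each $\alpha<\omega_1$ at most countably many $\equiv_\alpha$-classes among its models), and such that for every $L_{\omega_1\omega}$ sentence $\psi$ one of $\varphi\wedge\psi$, $\varphi\wedge\neg\psi$ has only countably many models. Moreover for each $\alpha<\omega_1$ only countably many $\Sigma^{\mathrm{in}}_\alpha$-types are realized in models of $\varphi$. For each $\beta<\omega_1$ exactly one $\equiv_\beta$-class of models of $\varphi$ is uncountable, denoted $\mathcal C_\beta$. $f(\alpha)=\min\{\beta:(\forall M\models\varphi)(M\notin\mathcal C_\alpha\Rightarrow\mathrm{cSR}(M)<\beta)\}$, $\mathfrak F=\{\alpha<\omega_1:f(\alpha)\le\alpha\}$. Sacks rank. A fragment is a countable set of $L_{\omega_1\omega}$ formulas closed under subformulas, substitution and the finitary connectives and quantifiers. For a structure $A$: $L^A_0$ is the finitary language; $T^A_\delta=\mathrm{Th}_{L^A_\delta}(A)$; $L^A_{\delta+1}$ is the least fragment containing $L^A_\delta$ and $\bigwedge p$ for every non-principal complete $L^A_\delta$-type $p$ realized in $A$; unions at limits. $\mathrm{sr}_{\mathrm{Sacks}}(A)$ is the least $\delta$ such that $A$ is the atomic model of $T^A_\delta$. Tree of nodes. $L_0$ is the fragment generated by $\varphi$, and $T$ is $\{\varphi\}$ together with the tautologies of $L_0$. A theory $T'$ in a fragment $L'$ is $\omega$-complete if for each sentence $F\in L'$, $F\in T'$ or $\neg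 F\in T'$, and whenever $\bigvee_iF_i\in T'$, some $F_i\in T'$; it is finitarily consistent if no contradiction is derivable from it by finite-length deductions. Nodes on level $0$: finitarily consistent $\omega$-complete extensions of $T$ in $L_0$. An $n$-type of a node $S$ (in fragment $L_S$) is a maximal set of $L_S(\bar x)$-formulas finitarily consistent with $S$; it is principal if generated over $S$ by one of its formulas. Nodes on level $\delta+1$: finitarily consistent $\omega$-complete extensions of a level-$\delta$ node $S$ in $L'_S$, the least fragment containing $L_S$ and $\bigwedge p$ for each non-principal $n$-type $p$ of $S$. Nodes on limit levels: unions along chains. Every model of a node is a model of $\varphi$. Fixed data, supplied by theorems of Sacks (Bounds on weak scattering, Thm. 4.9, Prop. 5.2 and Thm. 5.3): an increasing branch $(T_\delta)_{\delta<\omega_1}$ of nodes, $T_\delta$ on level $\delta$ with fragment $L_{T_\delta}$, unions at limits, $\Delta_1$ over $L(\omega_1,T)$, such that every $T_\delta$ has an atomic model $A_\delta$ of $\mathrm{sr}_{\mathrm{Sacks}}$ exactly $\delta$, and $A_{\delta+1}$ realizes a non-principal type of $T_\delta$; and a club $C_{5.3}\subseteq\omega_1$ (the ordinals $\omega_1^{L(\beta_\delta,T)}$ for the transitive collapses $L(\beta_\delta,T)$ of the $\Sigma_1$-hulls in Sacks' proof) such that for each $\lambda\in C_{5.3}$: $\lambda>\omega$ and $L(\lambda,T)$ is $\Sigma_1$-admissible; $B_\lambda\models T_\lambda$ realizes every non-principal $n$-type of $T_\lambda$, $\omega_1^{B_\lambda}=\lambda$ and $\mathrm{sr}_{\mathrm{Sacks}}(B_\lambda)=\lambda+1$.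 Fiber models at $\lambda$: countable $M\models T_\lambda$ with $\omega_1^M=\lambda$. For a fiber model $M$ and an $n$-type $q$ of $T_\lambda$ realized in $M$, $\Phi_M(q)$ is the complete $\Pi^{\mathrm{in}}_\lambda$-type (set of all $\Pi^{\mathrm{in}}_\lambda$ formulas satisfied) of any realizer of $q$ in $M$; this is well defined because any two realizers of $q$ in $M$ are automorphic. A set $\Gamma(\bar x)$ of $\Pi^{\mathrm{in}}_\lambda$ formulas is $\Sigma^{\mathrm{in}}_\lambda$-supported within $M$ by $\theta$ if $\theta(\bar x)$ is a (parameter-free) $\Sigma^{\mathrm{in}}_\lambda$ formula with $M\models\exists\bar x\,\theta$ and $M\models\forall\bar x(\theta\to\gamma)$ for every $\gamma\in\Gamma$. *)

theory Defs
  imports Complex_Main "HOL-Library.Countable_Set_Type" "HOL-Library.Nat_Bijection"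
begin

section \<open>The ordinal \<open>\<omega>\<^sub>1\<close>\<close>

typedef w1 = "Field (cardSuc natLeq)"
  using Field_cardSuc_not_empty[OF natLeq_Card_order] by auto

instantiation w1 :: wellorder
begin

definition less_eq_w1 :: "w1 \<Rightarrow> w1 \<Rightarrow> bool" where
  "(a::w1) \<le> b \<longleftrightarrow> (Rep_w1 a, Rep_w1 b) \<in> cardSuc natLeq"

definition less_w1 :: "w1 \<Rightarrow> w1 \<Rightarrow> bool" where
  "(a::w1) < b \<longleftrightarrow> a \<le> b \<and> a \<noteq> b"

instance
proof
  have wo: "Well_order (cardSuc natLeq)"
    by (rule cardSuc_Well_order[OF natLeq_Card_order])
  then have r: "Refl (cardSuc natLeq)" and t: "trans (cardSuc natLeq)"
    and as: "antisym (cardSuc natLeq)" and tot: "Total (cardSuc natLeq)"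
    and wf: "wf (cardSuc natLeq - Id)"
    by (auto simp: order_on_defs)
  fix x y z :: w1
  show refl: "x \<le> x"
    using r Rep_w1[of x] by (auto simp: less_eq_w1_def refl_on_def)
  show "x \<le> y \<Longrightarrow> y \<le> z \<Longrightarrow> x \<le> z"
    using t by (auto simp: less_eq_w1_def dest: transD)
  show anti: "x \<le> y \<Longrightarrow> y \<le> x \<Longrightarrow> x = y"
    using as by (auto simp: less_eq_w1_def Rep_w1_inject dest: antisymD)
  show "x \<le> y \<or> y \<le> x"
    using tot refl[unfolded less_eq_w1_def] Rep_w1[of x] Rep_w1[of y]
    by (cases "x = y") (auto simp: less_eq_w1_def total_on_def Rep_w1_inject)
  show "(x < y) = (x \<le> y \<and> \<not> y \<le> x)"
    using refl anti by (auto simp: less_w1_def)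
  fix P :: "w1 \<Rightarrow> bool" and a :: w1
  assume step: "\<And>x. (\<And>y. y < x \<Longrightarrow> P y) \<Longrightarrow> P x"
  have "wf (inv_image (cardSuc natLeq - Id) Rep_w1)"
    using wf by (rule wf_inv_image)
  then show "P a"
  proof (induction a rule: wf_induct_rule)
    case (less x)
    show ?case
      by (rule step, rule less) (auto simp: less_w1_def less_eq_w1_def Rep_w1_inject)
  qed
qed

end

lemma w1_unbounded: "\<exists>b. (a::w1) < b"
proof -
  have "\<not> finite (Field (cardSuc natLeq))"
    using cardSuc_finite[OF natLeq_Card_order] by (simp add: Field_natLeq)
  then obtain b where "b \<in> Field (cardSuc natLeq)" "Rep_w1 a \<noteq> b" "(Rep_w1 a, b) \<in> cardSuc natLeq"
    using infinite_Card_order_limit[OF cardSuc_Card_order[OF natLeq_Card_order] _ Rep_w1[of a]] by blast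
  then have "a < Abs_w1 b"
    by (auto simp: less_w1_def less_eq_w1_def Abs_w1_inverse)
  then show ?thesis ..
qed

definition o0 :: w1 where "o0 = (LEAST a. True)"

definition osuc :: "w1 \<Rightarrow> w1" where "osuc a = (LEAST b. a < b)"

definition olimit :: "w1 \<Rightarrow> bool" where
  "olimit a \<longleftrightarrow> a \<noteq> o0 \<and> (\<forall>b<a. osuc b < a)"

definition oomega :: w1 where "oomega = (LEAST a. olimit a)"

definition club :: "w1 set \<Rightarrow> bool" where
  "club C \<longleftrightarrow> (\<forall>a. \<exists>b\<in>C. a < b) \<and>
     (\<forall>d. olimit d \<and> (\<forall>a<d. \<exists>b\<in>C. a < b \<and> b < d) \<longrightarrow> d \<in> C)"

lemma less_osuc: "a < osuc a"
  unfolding osuc_def by (rule LeastI_ex) (rule w1_unbounded)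

text \<open>Iteration of \<open>s\<close> starting from \<open>z\<close>, with unions at limit stages.\<close>

function hier :: "'a set \<Rightarrow> ('a set \<Rightarrow> 'a set) \<Rightarrow> w1 \<Rightarrow> 'a set" where
  "hier z s d =
     (if d = o0 then z
      else if \<exists>c. c < d \<and> d = osuc c then s (hier z s (SOME c. c < d \<and> d = osuc c))
      else (\<Union>c\<in>{c. c < d}. hier z s c))"
  by pat_completeness auto
termination
proof (relation "inv_image {(x, y). x < y} (\<lambda>(z, s, d). d)")
  show "wf (inv_image {(x::w1, y). x < y} (\<lambda>(z, s, d). d))"
    by (rule wf_inv_image) (rule wf)
next
  fix z :: "'a set" and s :: "'a set \<Rightarrow> 'a set" and d :: w1
  assume "\<exists>c<d. d = osuc c"
  then have "(SOME c. c < d \<and> d = osuc c) < d"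
    by (rule someI2_ex) (erule conjunct1)
  then show "((z, s, SOME c. c < d \<and> d = osuc c), z, s, d) \<in> inv_image {(x, y). x < y} (\<lambda>(z, s, d). d)"
    by simp
qed auto

declare hier.simps [simp del]


section \<open>Formulas of \<open>L\<^bsub>\<omega>\<^sub>1\<omega>\<^esub>\<close>\<close>

text \<open>
  A symbol is a pair (index, arity); a countable vocabulary is given by a set of relation symbols
  and a set of function symbols (constants have arity 0). Bound variables are de Bruijn indices:
  \<open>Ex f\<close> binds variable 0 of \<open>f\<close>. Negation, countable disjunction and the existential quantifier
  are primitive. Disjunctions are indexed by countable sets, so that the conjunction of a type is
  a canonical formula.
\<close>

record vocab =
  rsym :: "(nat \<times> nat) set"
  fsym :: "(nat \<times> nat) set"

datatype tm = Var nat | Fn nat "tm list"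

datatype fm =
    Eq tm tm
  | Rel nat "tm list"
  | Neg fm
  | Disj "fm cset"
  | Ex fm

definition Conj :: "fm cset \<Rightarrow> fm" where "Conj F = Neg (Disj (cimage Neg F))"
definition All :: "fm \<Rightarrow> fm" where "All f = Neg (Ex (Neg f))"
definition And :: "fm \<Rightarrow> fm \<Rightarrow> fm" where "And f g = Conj (acset {f, g})"
definition Imp :: "fm \<Rightarrow> fm \<Rightarrow> fm" where "Imp f g = Disj (acset {Neg f, g})"
definition Exs :: "nat \<Rightarrow> fm \<Rightarrow> fm" where "Exs n f = (Ex ^^ n) f"
definition Alls :: "nat \<Rightarrow> fm \<Rightarrow> fm" where "Alls n f = (All ^^ n) f"

primrec tm_vars :: "tm \<Rightarrow> nat set" where
  "tm_vars (Var i) = {i}"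
| "tm_vars (Fn i ts) = \<Union> (set (map tm_vars ts))"

primrec fv :: "fm \<Rightarrow> nat set" where
  "fv (Eq s t) = tm_vars s \<union> tm_vars t"
| "fv (Rel i ts) = \<Union> (set (map tm_vars ts))"
| "fv (Neg f) = fv f"
| "fv (Disj F) = \<Union> (rcset (cimage fv F))"
| "fv (Ex f) = {i. Suc i \<in> fv f}"

primrec tm_in :: "vocab \<Rightarrow> tm \<Rightarrow> bool" where
  "tm_in V (Var i) = True"
| "tm_in V (Fn i ts) = ((i, length ts) \<in> fsym V \<and> list_all id (map (tm_in V) ts))"

text \<open>A countable disjunction is a formula only if it has finitely many free variables.\<close>

primrec wff :: "vocab \<Rightarrow> fm \<Rightarrow> bool" where
  "wff V (Eq s t) = (tm_in V s \<and> tm_in V t)"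
| "wff V (Rel i ts) = ((i, length ts) \<in> rsym V \<and> list_all (tm_in V) ts)"
| "wff V (Neg f) = wff V f"
| "wff V (Disj F) = (finite (fv (Disj F)) \<and> (\<forall>b \<in> rcset (cimage (wff V) F). b))"
| "wff V (Ex f) = wff V f"

definition sentence :: "vocab \<Rightarrow> fm \<Rightarrow> bool" where
  "sentence V f \<longleftrightarrow> wff V f \<and> fv f = {}"

primrec tm_subst :: "(nat \<Rightarrow> tm) \<Rightarrow> tm \<Rightarrow> tm" where
  "tm_subst s (Var i) = s i"
| "tm_subst s (Fn i ts) = Fn i (map (tm_subst s) ts)"

definition up :: "(nat \<Rightarrow> tm) \<Rightarrow> nat \<Rightarrow> tm" where
  "up s = case_nat (Var 0) (\<lambda>i. tm_subst (\<lambda>j. Var (Suc j)) (s i))"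

primrec subst :: "fm \<Rightarrow> (nat \<Rightarrow> tm) \<Rightarrow> fm" where
  "subst (Eq t u) s = Eq (tm_subst s t) (tm_subst s u)"
| "subst (Rel i ts) s = Rel i (map (tm_subst s) ts)"
| "subst (Neg f) s = Neg (subst f s)"
| "subst (Disj F) s = Disj (cimage (\<lambda>f. subst f s) F)"
| "subst (Ex f) s = Ex (subst f (up s))"

definition inst0 :: "tm \<Rightarrow> fm \<Rightarrow> fm" where
  "inst0 t f = subst f (case_nat t Var)"

definition lift :: "fm \<Rightarrow> fm" where
  "lift f = subst f (\<lambda>i. Var (Suc i))"

primrec finitary :: "fm \<Rightarrow> bool" where
  "finitary (Eq s t) = True"
| "finitary (Rel i ts) = True"
| "finitary (Neg f) = finitary f"
| "finitary (Disj F) = (finite (rcset F) \<and> (\<forall>b \<in> rcset (cimage finitary F). b))"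
| "finitary (Ex f) = finitary f"

primrec qfree :: "fm \<Rightarrow> bool" where
  "qfree (Eq s t) = True"
| "qfree (Rel i ts) = True"
| "qfree (Neg f) = qfree f"
| "qfree (Disj F) = (\<forall>b \<in> rcset (cimage qfree F). b)"
| "qfree (Ex f) = False"

inductive is_Sigma :: "w1 \<Rightarrow> fm \<Rightarrow> bool" and is_Pi :: "w1 \<Rightarrow> fm \<Rightarrow> bool" where
  Sigma_zero: "finitary f \<Longrightarrow> qfree f \<Longrightarrow> is_Sigma o0 f"
| Pi_zero: "finitary f \<Longrightarrow> qfree f \<Longrightarrow> is_Pi o0 f"
| Sigma_pos: "a \<noteq> o0 \<Longrightarrow> \<forall>g \<in> rcset F. \<exists>n h b. g = Exs n h \<and> b < a \<and> is_Pi b h \<Longrightarrow> is_Sigma a (Disj F)"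
| Pi_pos: "a \<noteq> o0 \<Longrightarrow> \<forall>g \<in> rcset F. \<exists>n h b. g = Alls n h \<and> b < a \<and> is_Sigma b h \<Longrightarrow> is_Pi a (Conj F)"

definition Sigma_in :: "vocab \<Rightarrow> w1 \<Rightarrow> fm set" where
  "Sigma_in V a = {f. wff V f \<and> is_Sigma a f}"

definition Pi_in :: "vocab \<Rightarrow> w1 \<Rightarrow> fm set" where
  "Pi_in V a = {f. wff V f \<and> is_Pi a f}"


section \<open>Countable structures\<close>

text \<open>
  Every countable structure has a copy whose domain is a subset of \<open>\<nat>\<close>; these copies represent
  the countable structures. The interpretation of a symbol of arity \<open>n\<close> is read off from lists of
  length \<open>n\<close> over the domain; all other values are irrelevant.
\<close>

record struc =
  Dom :: "nat set"
  RelI :: "nat \<Rightarrow> nat list \<Rightarrow> bool"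
  FunI :: "nat \<Rightarrow> nat list \<Rightarrow> nat"

definition structure_of :: "vocab \<Rightarrow> struc \<Rightarrow> bool" where
  "structure_of V M \<longleftrightarrow> Dom M \<noteq> {} \<and>
     (\<forall>(i, n) \<in> fsym V. \<forall>as \<in> lists (Dom M). length as = n \<longrightarrow> FunI M i as \<in> Dom M)"

definition tuples :: "struc \<Rightarrow> nat \<Rightarrow> nat list set" where
  "tuples M n = {as. set as \<subseteq> Dom M \<and> length as = n}"

primrec tm_val :: "struc \<Rightarrow> (nat \<Rightarrow> nat) \<Rightarrow> tm \<Rightarrow> nat" where
  "tm_val M v (Var i) = v i"
| "tm_val M v (Fn i ts) = FunI M i (map (tm_val M v) ts)"

primrec sat :: "struc \<Rightarrow> fm \<Rightarrow> (nat \<Rightarrow> nat) \<Rightarrow> bool" where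
  "sat M (Eq s t) = (\<lambda>v. tm_val M v s = tm_val M v t)"
| "sat M (Rel i ts) = (\<lambda>v. RelI M i (map (tm_val M v) ts))"
| "sat M (Neg f) = (\<lambda>v. \<not> sat M f v)"
| "sat M (Disj F) = (\<lambda>v. \<exists>P \<in> rcset (cimage (sat M) F). P v)"
| "sat M (Ex f) = (\<lambda>v. \<exists>a \<in> Dom M. sat M f (case_nat a v))"

definition holds :: "struc \<Rightarrow> fm \<Rightarrow> nat list \<Rightarrow> bool" where
  "holds M f as \<longleftrightarrow> sat M f (\<lambda>i. if i < length as then as ! i else undefined)"

definition models :: "struc \<Rightarrow> fm \<Rightarrow> bool" where
  "models M f \<longleftrightarrow> holds M f []"

definition models_all :: "vocab \<Rightarrow> struc \<Rightarrow> fm set \<Rightarrow> bool" where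
  "models_all V M S \<longleftrightarrow> structure_of V M \<and> (\<forall>f \<in> S. models M f)"

definition Mods :: "vocab \<Rightarrow> fm \<Rightarrow> struc set" where
  "Mods V f = {M. structure_of V M \<and> models M f}"

definition iso_struc :: "vocab \<Rightarrow> struc \<Rightarrow> struc \<Rightarrow> bool" where
  "iso_struc V M N \<longleftrightarrow> (\<exists>h. bij_betw h (Dom M) (Dom N) \<and>
     (\<forall>(i, n) \<in> rsym V. \<forall>as \<in> tuples M n. RelI M i as \<longleftrightarrow> RelI N i (map h as)) \<and>
     (\<forall>(i, n) \<in> fsym V. \<forall>as \<in> tuples M n. h (FunI M i as) = FunI N i (map h as)))"

definition iso_types :: "vocab \<Rightarrow> struc set \<Rightarrow> struc set set" where
  "iso_types V K = K // {(M, N). structure_of V M \<and> structure_of V N \<and> iso_struc V M N}"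

definition equiv_in :: "vocab \<Rightarrow> w1 \<Rightarrow> struc \<Rightarrow> struc \<Rightarrow> bool" where
  "equiv_in V a M N \<longleftrightarrow> (\<forall>f \<in> Pi_in V a. fv f = {} \<longrightarrow> (models M f \<longleftrightarrow> models N f))"

definition equiv_classes :: "vocab \<Rightarrow> fm \<Rightarrow> w1 \<Rightarrow> struc set set" where
  "equiv_classes V phi a = Mods V phi // {(M, N). M \<in> Mods V phi \<and> N \<in> Mods V phi \<and> equiv_in V a M N}"

definition scott_sentence :: "vocab \<Rightarrow> fm \<Rightarrow> struc \<Rightarrow> bool" where
  "scott_sentence V f M \<longleftrightarrow> sentence V f \<and>
     (\<forall>N. structure_of V N \<longrightarrow> (models N f \<longleftrightarrow> iso_struc V M N))"

definition cSR :: "vocab \<Rightarrow> struc \<Rightarrow> w1" where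
  "cSR V M = (LEAST a. \<exists>f \<in> Pi_in V (osuc a). scott_sentence V f M)"

text \<open>
  Complexity is taken up to logical equivalence, since an arbitrary sentence is not literally of
  the form \<open>\<Pi>\<close> or \<open>\<Sigma>\<close>. By Loewenheim-Skolem, countable structures suffice.
\<close>

definition qr :: "vocab \<Rightarrow> fm \<Rightarrow> w1" where
  "qr V f = (LEAST b. \<exists>g \<in> Pi_in V b \<union> Sigma_in V b. fv g = {} \<and>
     (\<forall>M. structure_of V M \<longrightarrow> (models M g \<longleftrightarrow> models M f)))"

definition Sigma_type :: "vocab \<Rightarrow> w1 \<Rightarrow> struc \<Rightarrow> nat list \<Rightarrow> fm set" where
  "Sigma_type V a M as = {f \<in> Sigma_in V a. fv f \<subseteq> {..<length as} \<and> holds M f as}"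

definition Pi_type :: "vocab \<Rightarrow> w1 \<Rightarrow> struc \<Rightarrow> nat list \<Rightarrow> fm set" where
  "Pi_type V a M as = {f \<in> Pi_in V a. fv f \<subseteq> {..<length as} \<and> holds M f as}"


section \<open>Minimal counterexamples to Vaught's conjecture\<close>

definition scattered :: "vocab \<Rightarrow> fm \<Rightarrow> bool" where
  "scattered V phi \<longleftrightarrow> (\<forall>a. countable (equiv_classes V phi a))"

definition minimal_counterexample :: "vocab \<Rightarrow> fm \<Rightarrow> bool" where
  "minimal_counterexample V phi \<longleftrightarrow>
     sentence V phi \<and>
     (card_of (iso_types V (Mods V phi)), cardSuc natLeq) \<in> ordIso \<and>
     scattered V phi \<and>
     (\<forall>psi. sentence V psi \<longrightarrow>
        countable (iso_types V (Mods V (And phi psi))) \<or>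
        countable (iso_types V (Mods V (And phi (Neg psi))))) \<and>
     (\<forall>a. countable {Sigma_type V a M as | M as. M \<in> Mods V phi \<and> set as \<subseteq> Dom M}) \<and>
     (\<forall>b. \<exists>!K. K \<in> equiv_classes V phi b \<and> uncountable (iso_types V K))"

definition C_class :: "vocab \<Rightarrow> fm \<Rightarrow> w1 \<Rightarrow> struc set" where
  "C_class V phi b = (THE K. K \<in> equiv_classes V phi b \<and> uncountable (iso_types V K))"

definition f_bound :: "vocab \<Rightarrow> fm \<Rightarrow> w1 \<Rightarrow> w1" where
  "f_bound V phi a = (LEAST b. \<forall>M \<in> Mods V phi. M \<notin> C_class V phi a \<longrightarrow> cSR V M < b)"

definition frakF :: "vocab \<Rightarrow> fm \<Rightarrow> w1 set" where
  "frakF V phi = {a. f_bound V phi a \<le> a}"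


section \<open>Computability relative to an oracle\<close>

text \<open>
  \<open>recf X n f\<close>: the total function \<open>f\<close>, restricted to lists of length \<open>n\<close>, is \<open>X\<close>-recursive
  (closure under composition, primitive recursion and minimization of regular functions).
\<close>

inductive recf :: "nat set \<Rightarrow> nat \<Rightarrow> (nat list \<Rightarrow> nat) \<Rightarrow> bool" for X where
  recf_zero: "recf X n (\<lambda>xs. 0)"
| recf_suc: "recf X 1 (\<lambda>xs. Suc (hd xs))"
| recf_proj: "i < n \<Longrightarrow> recf X n (\<lambda>xs. xs ! i)"
| recf_oracle: "recf X 1 (\<lambda>xs. if hd xs \<in> X then 1 else 0)"
| recf_comp: "recf X (length gs) f \<Longrightarrow> \<forall>g \<in> set gs. recf X n g \<Longrightarrow> recf X n (\<lambda>xs. f (map (\<lambda>g. g xs) gs))"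
| recf_prec: "recf X n f \<Longrightarrow> recf X (Suc (Suc n)) g \<Longrightarrow>
    recf X (Suc n) (\<lambda>xs. rec_nat (f (tl xs)) (\<lambda>k r. g (k # r # tl xs)) (hd xs))"
| recf_min: "recf X (Suc n) f \<Longrightarrow> \<forall>xs. length xs = n \<longrightarrow> (\<exists>y. f (y # xs) = 0) \<Longrightarrow>
    recf X n (\<lambda>xs. LEAST y. f (y # xs) = 0)"

definition computes :: "nat set \<Rightarrow> nat set \<Rightarrow> bool" where
  "computes X A \<longleftrightarrow> (\<exists>f. recf X 1 f \<and> (\<forall>x. f [x] = (if x \<in> A then 1 else 0)))"

definition omega1_rel :: "nat set \<Rightarrow> w1" where
  "omega1_rel X = (LEAST a. \<not> (\<exists>R :: nat rel. computes X (prod_encode ` R) \<and>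
      (R, {(b, c). b \<le> c \<and> c < a}) \<in> ordIso))"

definition computes_struc :: "nat set \<Rightarrow> vocab \<Rightarrow> struc \<Rightarrow> bool" where
  "computes_struc X V N \<longleftrightarrow>
     computes X (Dom N) \<and>
     computes X {list_encode (i # as) | i as.
       (i, length as) \<in> rsym V \<and> set as \<subseteq> Dom N \<and> RelI N i as} \<and>
     computes X {list_encode (i # FunI N i as # as) | i as.
       (i, length as) \<in> fsym V \<and> set as \<subseteq> Dom N}"

definition omega1_struc :: "vocab \<Rightarrow> struc \<Rightarrow> w1" where
  "omega1_struc V M = (LEAST a. \<exists>X N. structure_of V N \<and> iso_struc V M N \<and>
      computes_struc X V N \<and> a = omega1_rel X)"


section \<open>Hereditarily countable sets and \<open>L(\<alpha>,T)\<close>\<close>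

text \<open>The type of hereditarily countable sets contains \<open>L(\<alpha>,T)\<close> for countable \<open>\<alpha>\<close>, and
  includes \<open>L(\<omega>\<^sub>1,T)\<close>, when \<open>T\<close> is hereditarily countable.\<close>

datatype hset = HSet "hset cset"

primrec elts :: "hset \<Rightarrow> hset set" where
  "elts (HSet c) = rcset c"

definition hset_of :: "hset set \<Rightarrow> hset" where
  "hset_of A = HSet (acset A)"

definition hpair :: "hset \<Rightarrow> hset \<Rightarrow> hset" where
  "hpair x y = hset_of {hset_of {x}, hset_of {x, y}}"

primrec hnat :: "nat \<Rightarrow> hset" where
  "hnat 0 = hset_of {}"
| "hnat (Suc n) = hset_of (insert (hnat n) (elts (hnat n)))"

primrec htup :: "hset list \<Rightarrow> hset" where
  "htup [] = hset_of {}"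
| "htup (x # xs) = hpair x (htup xs)"

function hord :: "w1 \<Rightarrow> hset" where
  "hord a = hset_of (hord ` {b. b < a})"
  by pat_completeness auto
termination
  by (relation "{(x, y). x < y}") (auto simp: wf)

declare hord.simps [simp del]

inductive_set trcl_sing :: "hset \<Rightarrow> hset set" for x where
  "x \<in> trcl_sing x"
| "y \<in> trcl_sing x \<Longrightarrow> z \<in> elts y \<Longrightarrow> z \<in> trcl_sing x"

datatype sfm =
    SMem nat nat
  | SEq nat nat
  | SNeg sfm
  | SAnd sfm sfm
  | SBEx nat nat sfm
  | SEx nat sfm

text \<open>\<open>SBEx x y f\<close> is the bounded quantification \<open>\<exists>x \<in> y. f\<close>.\<close>

primrec ssat :: "hset set \<Rightarrow> sfm \<Rightarrow> (nat \<Rightarrow> hset) \<Rightarrow> bool" where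
  "ssat D (SMem x y) = (\<lambda>v. v x \<in> elts (v y))"
| "ssat D (SEq x y) = (\<lambda>v. v x = v y)"
| "ssat D (SNeg f) = (\<lambda>v. \<not> ssat D f v)"
| "ssat D (SAnd f g) = (\<lambda>v. ssat D f v \<and> ssat D g v)"
| "ssat D (SBEx x y f) = (\<lambda>v. \<exists>a \<in> elts (v y) \<inter> D. ssat D f (v(x := a)))"
| "ssat D (SEx x f) = (\<lambda>v. \<exists>a \<in> D. ssat D f (v(x := a)))"

primrec delta0 :: "sfm \<Rightarrow> bool" where
  "delta0 (SMem x y) = True"
| "delta0 (SEq x y) = True"
| "delta0 (SNeg f) = delta0 f"
| "delta0 (SAnd f g) = (delta0 f \<and> delta0 g)"
| "delta0 (SBEx x y f) = delta0 f"
| "delta0 (SEx x f) = False"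

inductive sigma1 :: "sfm \<Rightarrow> bool" where
  "delta0 f \<Longrightarrow> sigma1 f"
| "sigma1 f \<Longrightarrow> sigma1 (SEx x f)"

definition definable_subsets :: "hset set \<Rightarrow> hset set" where
  "definable_subsets D = {s. \<exists>f v. range v \<subseteq> D \<and> elts s = {a \<in> D. ssat D f (v(0 := a))}}"

definition Llevel :: "hset \<Rightarrow> w1 \<Rightarrow> hset set" where
  "Llevel t a = hier (trcl_sing t) definable_subsets a"

definition Lomega1 :: "hset \<Rightarrow> hset set" where
  "Lomega1 t = (\<Union>a. Llevel t a)"

text \<open>Transitive models of Kripke-Platek set theory; foundation and extensionality are automatic.\<close>

definition admissible :: "hset set \<Rightarrow> bool" where
  "admissible D \<longleftrightarrow> D \<noteq> {} \<and>
     (\<forall>x \<in> D. elts x \<subseteq> D) \<and>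
     (\<forall>x \<in> D. \<forall>y \<in> D. hset_of {x, y} \<in> D) \<and>
     (\<forall>x \<in> D. hset_of (\<Union> (elts ` elts x)) \<in> D) \<and>
     (\<forall>f v. \<forall>x \<in> D. delta0 f \<and> range v \<subseteq> D \<longrightarrow>
        (\<exists>s \<in> D. elts s = {a \<in> elts x. ssat D f (v(0 := a))})) \<and>
     (\<forall>f v. \<forall>x \<in> D. delta0 f \<and> range v \<subseteq> D \<and>
        (\<forall>a \<in> elts x. \<exists>b \<in> D. ssat D f (v(0 := a, 1 := b))) \<longrightarrow>
        (\<exists>y \<in> D. \<forall>a \<in> elts x. \<exists>b \<in> elts y. ssat D f (v(0 := a, 1 := b))))"

text \<open>\<open>\<Delta>\<^sub>1\<close> over \<open>D\<close>, with parameters from \<open>D\<close>.\<close>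

definition delta1_over :: "hset set \<Rightarrow> (hset \<Rightarrow> hset \<Rightarrow> bool) \<Rightarrow> bool" where
  "delta1_over D P \<longleftrightarrow> (\<exists>f g v. sigma1 f \<and> sigma1 g \<and> range v \<subseteq> D \<and>
     (\<forall>x \<in> D. \<forall>y \<in> D. (P x y \<longleftrightarrow> ssat D f (v(0 := x, 1 := y))) \<and>
                       (\<not> P x y \<longleftrightarrow> ssat D g (v(0 := x, 1 := y)))))"

primrec tm_code :: "tm \<Rightarrow> hset" where
  "tm_code (Var i) = htup [hnat 0, hnat i]"
| "tm_code (Fn i ts) = htup (hnat 1 # hnat i # map tm_code ts)"

primrec fm_code :: "fm \<Rightarrow> hset" where
  "fm_code (Eq s t) = htup [hnat 0, tm_code s, tm_code t]"
| "fm_code (Rel i ts) = htup (hnat 1 # hnat i # map tm_code ts)"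
| "fm_code (Neg f) = htup [hnat 2, fm_code f]"
| "fm_code (Disj F) = htup [hnat 3, HSet (cimage fm_code F)]"
| "fm_code (Ex f) = htup [hnat 4, fm_code f]"

definition th_code :: "fm set \<Rightarrow> hset" where
  "th_code S = hset_of (fm_code ` S)"


section \<open>Fragments, finite-length deductions and types\<close>

text \<open>As usual for fragments, all atomic formulas of the vocabulary are included.\<close>

definition fragment :: "vocab \<Rightarrow> fm set \<Rightarrow> bool" where
  "fragment V L \<longleftrightarrow> countable L \<and> (\<forall>f \<in> L. wff V f) \<and>
     (\<forall>s t. wff V (Eq s t) \<longrightarrow> Eq s t \<in> L) \<and>
     (\<forall>i ts. wff V (Rel i ts) \<longrightarrow> Rel i ts \<in> L) \<and>
     (\<forall>f. Neg f \<in> L \<longleftrightarrow> f \<in> L) \<and>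
     (\<forall>f. Ex f \<in> L \<longleftrightarrow> f \<in> L) \<and>
     (\<forall>F. Disj F \<in> L \<longrightarrow> rcset F \<subseteq> L) \<and>
     (\<forall>F. finite (rcset F) \<and> rcset F \<subseteq> L \<longrightarrow> Disj F \<in> L) \<and>
     (\<forall>f \<in> L. \<forall>s. (\<forall>i. tm_in V (s i)) \<longrightarrow> subst f s \<in> L)"

text \<open>If no fragment contains \<open>X\<close>, the value is \<open>UNIV\<close>, which is not a fragment.\<close>

definition least_fragment :: "vocab \<Rightarrow> fm set \<Rightarrow> fm set" where
  "least_fragment V X = \<Inter> {L. fragment V L \<and> X \<subseteq> L}"

text \<open>
  Deductions of finite length: a disjunction is eliminated only when it is finite, so every
  derivation is a finite tree. Free variables are treated as constants.
\<close>

inductive derives :: "fm set \<Rightarrow> fm \<Rightarrow> bool" where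
  assm: "f \<in> G \<Longrightarrow> derives G f"
| negI: "derives (insert f G) g \<Longrightarrow> derives (insert f G) (Neg g) \<Longrightarrow> derives G (Neg f)"
| negE: "derives (insert (Neg f) G) g \<Longrightarrow> derives (insert (Neg f) G) (Neg g) \<Longrightarrow> derives G f"
| disjI: "f \<in> rcset F \<Longrightarrow> derives G f \<Longrightarrow> derives G (Disj F)"
| disjE: "finite (rcset F) \<Longrightarrow> derives G (Disj F) \<Longrightarrow>
    \<forall>f \<in> rcset F. derives (insert f G) g \<Longrightarrow> derives G g"
| exI: "derives G (inst0 t f) \<Longrightarrow> derives G (Ex f)"
| exE: "derives G (Ex f) \<Longrightarrow> derives (insert f (lift ` G)) (lift g) \<Longrightarrow> derives G g"
| eqI: "derives G (Eq t t)"
| eqE: "derives G (Eq s t) \<Longrightarrow> derives G (inst0 s f) \<Longrightarrow> derives G (inst0 t f)"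

definition consistent :: "fm set \<Rightarrow> bool" where
  "consistent G \<longleftrightarrow> \<not> (\<exists>f. derives G f \<and> derives G (Neg f))"

definition omega_complete :: "fm set \<Rightarrow> fm set \<Rightarrow> bool" where
  "omega_complete L S \<longleftrightarrow> S \<subseteq> {f \<in> L. fv f = {}} \<and>
     (\<forall>f \<in> L. fv f = {} \<longrightarrow> f \<in> S \<or> Neg f \<in> S) \<and>
     (\<forall>F. Disj F \<in> S \<longrightarrow> (\<exists>f \<in> rcset F. f \<in> S))"

text \<open>The free variables of an \<open>n\<close>-type are \<open>0, \<dots>, n - 1\<close>.\<close>

definition ntype :: "fm set \<Rightarrow> fm set \<Rightarrow> nat \<Rightarrow> fm set \<Rightarrow> bool" where
  "ntype L S n p \<longleftrightarrow> p \<subseteq> {f \<in> L. fv f \<subseteq> {..<n}} \<and> consistent (S \<union> p) \<and>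
     (\<forall>p'. p \<subseteq> p' \<and> p' \<subseteq> {f \<in> L. fv f \<subseteq> {..<n}} \<and> consistent (S \<union> p') \<longrightarrow> p' = p)"

definition principal :: "fm set \<Rightarrow> nat \<Rightarrow> fm set \<Rightarrow> bool" where
  "principal S n p \<longleftrightarrow> (\<exists>f \<in> p. \<forall>g \<in> p. derives S (Alls n (Imp f g)))"

definition realizes :: "struc \<Rightarrow> nat \<Rightarrow> nat list \<Rightarrow> fm set \<Rightarrow> bool" where
  "realizes M n as p \<longleftrightarrow> as \<in> tuples M n \<and> (\<forall>f \<in> p. holds M f as)"

definition tp :: "fm set \<Rightarrow> struc \<Rightarrow> nat list \<Rightarrow> fm set" where
  "tp L M as = {f \<in> L. fv f \<subseteq> {..<length as} \<and> holds M f as}"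

definition Th :: "fm set \<Rightarrow> struc \<Rightarrow> fm set" where
  "Th L M = {f \<in> L. fv f = {} \<and> models M f}"

definition atomic_model :: "vocab \<Rightarrow> fm set \<Rightarrow> fm set \<Rightarrow> struc \<Rightarrow> bool" where
  "atomic_model V L S M \<longleftrightarrow> models_all V M S \<and>
     (\<forall>n. \<forall>as \<in> tuples M n. principal S n (tp L M as))"


section \<open>Sacks rank\<close>

definition LA :: "vocab \<Rightarrow> struc \<Rightarrow> w1 \<Rightarrow> fm set" where
  "LA V A = hier {f. wff V f \<and> finitary f}
     (\<lambda>L. least_fragment V (L \<union> {Conj (acset p) | p n as.
        as \<in> tuples A n \<and> p = tp L A as \<and> \<not> principal (Th L A) n p}))"

definition sr_Sacks :: "vocab \<Rightarrow> struc \<Rightarrow> w1" where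
  "sr_Sacks V A = (LEAST d. atomic_model V (LA V A d) (Th (LA V A d) A) A)"


section \<open>The tree of nodes\<close>

definition L_zero :: "vocab \<Rightarrow> fm \<Rightarrow> fm set" where
  "L_zero V phi = least_fragment V {phi}"

definition base_theory :: "vocab \<Rightarrow> fm \<Rightarrow> fm set" where
  "base_theory V phi = insert phi {f \<in> L_zero V phi. fv f = {} \<and> (\<forall>M. structure_of V M \<longrightarrow> models M f)}"

definition root_node :: "vocab \<Rightarrow> fm \<Rightarrow> fm set \<Rightarrow> fm set \<Rightarrow> bool" where
  "root_node V phi L S \<longleftrightarrow> L = L_zero V phi \<and> base_theory V phi \<subseteq> S \<and>
     omega_complete L S \<and> consistent S"

definition next_fragment :: "vocab \<Rightarrow> fm set \<Rightarrow> fm set \<Rightarrow> fm set" where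
  "next_fragment V L S = least_fragment V
     (L \<union> {Conj (acset p) | p n. ntype L S n p \<and> \<not> principal S n p})"

definition child_node :: "vocab \<Rightarrow> fm set \<Rightarrow> fm set \<Rightarrow> fm set \<Rightarrow> fm set \<Rightarrow> bool" where
  "child_node V L S L' S' \<longleftrightarrow> fragment V L' \<and> L' = next_fragment V L S \<and> S \<subseteq> S' \<and>
     omega_complete L' S' \<and> consistent S'"

inductive node :: "vocab \<Rightarrow> fm \<Rightarrow> w1 \<Rightarrow> fm set \<Rightarrow> fm set \<Rightarrow> bool" for V phi where
  node_zero: "root_node V phi L S \<Longrightarrow> node V phi o0 L S"
| node_suc: "node V phi d L S \<Longrightarrow> child_node V L S L' S' \<Longrightarrow> node V phi (osuc d) L' S'"
| node_limit: "olimit l \<Longrightarrow> \<forall>d<l. node V phi d (Ls d) (Ss d) \<Longrightarrow>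
    \<forall>d<l. \<forall>c\<le>d. Ls c \<subseteq> Ls d \<and> Ss c \<subseteq> Ss d \<Longrightarrow>
    node V phi l (\<Union>d\<in>{d. d < l}. Ls d) (\<Union>d\<in>{d. d < l}. Ss d)"

definition branch :: "vocab \<Rightarrow> fm \<Rightarrow> (w1 \<Rightarrow> fm set) \<Rightarrow> (w1 \<Rightarrow> fm set) \<Rightarrow> bool" where
  "branch V phi L T \<longleftrightarrow>
     (\<forall>d. node V phi d (L d) (T d)) \<and>
     (\<forall>d. child_node V (L d) (T d) (L (osuc d)) (T (osuc d))) \<and>
     (\<forall>l. olimit l \<longrightarrow> L l = (\<Union>d\<in>{d. d < l}. L d) \<and> T l = (\<Union>d\<in>{d. d < l}. T d))"

text \<open>
  The data supplied by Sacks' theorems: a branch \<open>T\<close> with fragments \<open>L\<close>, atomic models \<open>A\<close>,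
  a club \<open>C\<close>, and the models \<open>B l\<close> for \<open>l\<close> in \<open>C\<close>.
\<close>

definition sacks_data ::
  "vocab \<Rightarrow> fm \<Rightarrow> (w1 \<Rightarrow> fm set) \<Rightarrow> (w1 \<Rightarrow> fm set) \<Rightarrow> (w1 \<Rightarrow> struc) \<Rightarrow> w1 set \<Rightarrow> (w1 \<Rightarrow> struc) \<Rightarrow> bool"
where
  "sacks_data V phi L T A C B \<longleftrightarrow>
     branch V phi L T \<and>
     (\<forall>d. th_code (T d) \<in> Lomega1 (th_code (base_theory V phi))) \<and>
     delta1_over (Lomega1 (th_code (base_theory V phi)))
       (\<lambda>x y. \<exists>d. x = hord d \<and> y = th_code (T d)) \<and>
     (\<forall>d. atomic_model V (L d) (T d) (A d) \<and> sr_Sacks V (A d) = d) \<and>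
     (\<forall>d. \<exists>n p as. ntype (L d) (T d) n p \<and> \<not> principal (T d) n p \<and>
        realizes (A (osuc d)) n as p) \<and>
     club C \<and>
     (\<forall>l \<in> C. oomega < l \<and>
        admissible (Llevel (th_code (base_theory V phi)) l) \<and>
        models_all V (B l) (T l) \<and>
        (\<forall>n p. ntype (L l) (T l) n p \<and> \<not> principal (T l) n p \<longrightarrow> (\<exists>as. realizes (B l) n as p)) \<and>
        omega1_struc V (B l) = l \<and>
        sr_Sacks V (B l) = osuc l)"


section \<open>Fiber models and supported types\<close>

definition S_circ :: "vocab \<Rightarrow> fm \<Rightarrow> w1 set \<Rightarrow> w1 set" where
  "S_circ V phi C = frakF V phi \<inter> C \<inter> {l. qr V phi < l}"

definition fiber_model :: "vocab \<Rightarrow> (w1 \<Rightarrow> fm set) \<Rightarrow> w1 \<Rightarrow> struc \<Rightarrow> bool" where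
  "fiber_model V T l M \<longleftrightarrow> models_all V M (T l) \<and> omega1_struc V M = l"

text \<open>Any two realizers of \<open>q\<close> in a fiber model at \<open>l\<close> have the same \<open>\<Pi>\<close>-type of level \<open>l\<close>.\<close>

definition Phi :: "vocab \<Rightarrow> w1 \<Rightarrow> struc \<Rightarrow> nat \<Rightarrow> fm set \<Rightarrow> fm set" where
  "Phi V l M n q = Pi_type V l M (SOME as. realizes M n as q)"

definition supports :: "vocab \<Rightarrow> w1 \<Rightarrow> struc \<Rightarrow> nat \<Rightarrow> fm \<Rightarrow> fm set \<Rightarrow> bool" where
  "supports V l M n theta G \<longleftrightarrow> theta \<in> Sigma_in V l \<and> fv theta \<subseteq> {..<n} \<and>
     models M (Exs n theta) \<and> (\<forall>g \<in> G. models M (Alls n (Imp theta g)))"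

end

theory Submission
  imports Defs
begin

text \<open>
  Back and forth along the branch: if two tuples of models of \<open>T\<^sub>\<delta>\<close> have the same type in the
  fragment of level \<open>\<delta> + 1\<close>, every extension of one tuple is matched by an extension of the other
  with the same type in the fragment of level \<open>\<delta>\<close>. Indeed this type is either generated by a
  single formula or its conjunction belongs to the next fragment, so that its realizability
  is expressed at level \<open>\<delta> + 1\<close>. By induction on \<open>\<alpha>\<close>, the type in the fragment of level \<open>\<alpha>\<close>
  determines all \<open>\<Sigma>\<^sub>\<alpha>\<close> and \<open>\<Pi>\<^sub>\<alpha>\<close> formulas of a tuple, independently of the model of \<open>T\<^sub>\<alpha>\<close>.
  Hence \<open>q\<close> alone determines \<open>\<Gamma>\<close>, and the support by \<open>\<theta>\<close>, being a matter of
  \<open>\<Sigma>\<^sub>\<lambda>\<close> and \<open>\<Pi>\<^sub>\<lambda>\<close> formulas, transfers from \<open>M\<close> to \<open>M'\<close>.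
\<close>

section \<open>Ordinals\<close>

lemma osuc_le: "a < b \<Longrightarrow> osuc a \<le> b"
  unfolding osuc_def by (rule Least_le)

lemma w1_cases:
  obtains "d = o0" | c where "c < d" "d = osuc c" | "olimit d"
proof (cases "d = o0 \<or> olimit d")
  case False
  then obtain b where "b < d" "\<not> osuc b < d"
    by (auto simp: olimit_def)
  with osuc_le[of b d] have "d = osuc b"
    by simp
  with \<open>b < d\<close> show thesis
    using that by blast
qed (use that in blast)

lemma not_less_o0 [simp]: "\<not> a < o0"
  unfolding o0_def by (simp add: leD Least_le)

lemma o0_less: "a \<noteq> o0 \<Longrightarrow> o0 < a"
  using not_less_o0[of a] by (auto simp: neq_iff)

lemma osuc_neq_o0: "osuc d \<noteq> o0"
  using less_osuc[of d] by auto

section \<open>Substitution and satisfaction\<close>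

lemma tm_val_cong: "(\<And>i. i \<in> tm_vars t \<Longrightarrow> v i = w i) \<Longrightarrow> tm_val M v t = tm_val M w t"
proof (induction t)
  case (Fn i ts)
  then have "map (tm_val M v) ts = map (tm_val M w) ts"
    by auto
  then show ?case
    by (simp del: map_eq_conv)
qed simp

lemma sat_cong: "(\<And>i. i \<in> fv f \<Longrightarrow> v i = w i) \<Longrightarrow> sat M f v = sat M f w"
proof (induction f arbitrary: v w)
  case (Eq s t)
  then show ?case
    using tm_val_cong[of s v w M] tm_val_cong[of t v w M] by auto
next
  case (Rel i ts)
  then have "map (tm_val M v) ts = map (tm_val M w) ts"
    by (auto intro!: tm_val_cong)
  then show ?case
    by (simp del: map_eq_conv)
next
  case (Neg f)
  then show ?case
    by (metis fv.simps(3) sat.simps(3))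
next
  case (Disj F)
  have "sat M f v = sat M f w" if "f \<in> rcset F" for f
    by (rule Disj.IH[OF that]) (use Disj.prems that in \<open>auto simp: cimage.rep_eq\<close>)
  then show ?case
    by (auto simp: cimage.rep_eq)
next
  case (Ex f)
  have "sat M f (case_nat a v) = sat M f (case_nat a w)" for a
    by (rule Ex.IH) (use Ex.prems in \<open>auto split: nat.split\<close>)
  then show ?case
    by simp
qed

lemma tm_val_subst: "tm_val M v (tm_subst s t) = tm_val M (\<lambda>i. tm_val M v (s i)) t"
  by (induction t) (auto simp: comp_def cong: map_cong)

lemma tm_val_up:
  "tm_val M (case_nat a v) (up s i) = case_nat a (\<lambda>i. tm_val M v (s i)) i"
  by (auto simp: up_def tm_val_subst split: nat.split)

lemma sat_subst: "sat M (subst f s) v = sat M f (\<lambda>i. tm_val M v (s i))"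
proof (induction f arbitrary: s v)
  case (Rel i ts)
  show ?case
    by (simp add: tm_val_subst comp_def)
next
  case (Ex f)
  show ?case
    by (simp add: Ex.IH tm_val_up[abs_def])
qed (auto simp: tm_val_subst cimage.rep_eq)

lemma sat_inst0: "sat M (inst0 t f) v = sat M f (case_nat (tm_val M v t) v)"
proof -
  have "(\<lambda>i. tm_val M v (case_nat t Var i)) = case_nat (tm_val M v t) v"
    by (auto split: nat.split)
  then show ?thesis
    by (simp add: inst0_def sat_subst)
qed

lemma sat_lift: "sat M (lift f) (case_nat a v) = sat M f v"
  by (simp add: lift_def sat_subst)

lemma tm_vars_subst: "tm_vars (tm_subst s t) = (\<Union>i\<in>tm_vars t. tm_vars (s i))"
  by (induction t) auto

lemma fv_subst: "fv (subst f s) \<subseteq> (\<Union>i\<in>fv f. tm_vars (s i))"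
proof (induction f arbitrary: s)
  case (Ex f)
  show ?case
  proof
    fix j assume "j \<in> fv (subst (Ex f) s)"
    then obtain i where i: "i \<in> fv f" "Suc j \<in> tm_vars (up s i)"
      using Ex.IH[of "up s"] by auto
    then show "j \<in> (\<Union>i\<in>fv (Ex f). tm_vars (s i))"
      by (cases i) (auto simp: up_def tm_vars_subst)
  qed
qed (force simp: tm_vars_subst cimage.rep_eq)+

section \<open>Satisfaction by tuples\<close>

lemma holds_Neg [simp]: "holds M (Neg f) as \<longleftrightarrow> \<not> holds M f as"
  by (simp add: holds_def)

lemma holds_Disj: "holds M (Disj F) as \<longleftrightarrow> (\<exists>f\<in>rcset F. holds M f as)"
  by (auto simp: holds_def cimage.rep_eq)

lemma holds_Conj: "holds M (Conj F) as \<longleftrightarrow> (\<forall>f\<in>rcset F. holds M f as)"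
  by (simp add: Conj_def holds_Disj cimage.rep_eq)

lemma rcset_acset_pair [simp]: "rcset (acset {f, g}) = {f, g}"
  by (rule acset_inverse) simp

lemma holds_Imp [simp]: "holds M (Imp f g) as \<longleftrightarrow> (holds M f as \<longrightarrow> holds M g as)"
  by (auto simp: Imp_def holds_Disj)

lemma holds_Ex: "holds M (Ex f) as \<longleftrightarrow> (\<exists>a\<in>Dom M. holds M f (a # as))"
proof -
  have "case_nat a (\<lambda>i. if i < length as then as ! i else undefined) =
      (\<lambda>i. if i < length (a # as) then (a # as) ! i else undefined)" for a
    by (auto split: nat.split)
  then show ?thesis
    by (simp add: holds_def)
qed

lemma holds_Exs: "holds M (Exs n f) as \<longleftrightarrow> (\<exists>cs\<in>tuples M n. holds M f (cs @ as))"
proof (induction n arbitrary: as)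
  case 0
  then show ?case
    by (auto simp: Exs_def tuples_def)
next
  case (Suc n)
  have "holds M (Exs (Suc n) f) as \<longleftrightarrow> (\<exists>a\<in>Dom M. \<exists>cs\<in>tuples M n. holds M f (cs @ a # as))"
    using Suc by (simp add: Exs_def holds_Ex)
  \<comment> \<open>The outermost quantifier chooses the last entry of the block, hence the witness
    \<open>cs @ [a]\<close> and the case split of \<open>cs\<close> at its end.\<close>
  also have "\<dots> \<longleftrightarrow> (\<exists>cs\<in>tuples M (Suc n). holds M f (cs @ as))"
  proof safe
    fix a cs assume "a \<in> Dom M" "cs \<in> tuples M n" "holds M f (cs @ a # as)"
    then show "\<exists>cs\<in>tuples M (Suc n). holds M f (cs @ as)"
      by (intro bexI[of _ "cs @ [a]"]) (auto simp: tuples_def)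
  next
    fix cs assume "cs \<in> tuples M (Suc n)" "holds M f (cs @ as)"
    then show "\<exists>a\<in>Dom M. \<exists>cs\<in>tuples M n. holds M f (cs @ a # as)"
      by (cases cs rule: rev_exhaust) (force simp: tuples_def)+
  qed
  finally show ?case .
qed

lemma Alls_Suc: "Alls (Suc n) f = All (Alls n f)"
  by (simp add: Alls_def)

lemma holds_Alls: "holds M (Alls n f) as \<longleftrightarrow> (\<forall>cs\<in>tuples M n. holds M f (cs @ as))"
proof -
  have "holds M (Alls n f) as \<longleftrightarrow> \<not> holds M (Exs n (Neg f)) as"
  proof (induction n arbitrary: as)
    case (Suc n)
    then show ?case
      by (simp add: Alls_Suc All_def holds_Ex Exs_def)
  qed (simp add: Alls_def Exs_def)
  then show ?thesis
    by (simp add: holds_Exs)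
qed

lemma holds_eq_sat:
  assumes "fv f \<subseteq> {..<length as}" "\<And>i. i < length as \<Longrightarrow> v i = as ! i"
  shows "holds M f as = sat M f v"
  unfolding holds_def by (rule sat_cong) (use assms in auto)

lemma holds_append:
  assumes "fv f \<subseteq> {..<length as}"
  shows "holds M f (as @ bs) = holds M f as"
  unfolding holds_def by (rule sat_cong) (use assms in \<open>auto simp: nth_append\<close>)

lemma wff_Exs [simp]: "wff V (Exs n f) = wff V f"
  unfolding Exs_def by (induction n) auto

lemma wff_Alls [simp]: "wff V (Alls n f) = wff V f"
  unfolding Alls_def by (induction n) (auto simp: All_def)

lemma fv_Exs: "fv (Exs n f) = {i. i + n \<in> fv f}"
  unfolding Exs_def by (induction n) auto

lemma fv_Alls: "fv (Alls n f) = {i. i + n \<in> fv f}"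
  unfolding Alls_def by (induction n) (auto simp: All_def)

text \<open>With \<open>A = fv f\<close> the left set consists of the free variables of
  \<open>Exs n f\<close> and of \<open>Alls n f\<close>; this converts between bounds before and
  after a block of \<open>n\<close> quantifiers.\<close>

lemma fv_shift_subset:
  fixes A :: "nat set"
  shows "{i. i + n \<in> A} \<subseteq> {..<m} \<longleftrightarrow> A \<subseteq> {..<n + m}"
proof
  assume *: "{i. i + n \<in> A} \<subseteq> {..<m}"
  show "A \<subseteq> {..<n + m}"
  proof
    fix x assume "x \<in> A"
    with * have "n \<le> x \<Longrightarrow> x - n < m"
      by (auto simp: subset_iff)
    then show "x \<in> {..<n + m}"
      by (cases "n \<le> x") auto
  qed
qed force

lemma wff_Conj: "wff V (Conj F) \<Longrightarrow> f \<in> rcset F \<Longrightarrow> wff V f"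
  by (auto simp: Conj_def cimage.rep_eq)

lemma wff_Disj: "wff V (Disj F) \<Longrightarrow> f \<in> rcset F \<Longrightarrow> wff V f"
  by (auto simp: cimage.rep_eq)

lemma fv_Conj: "fv (Conj F) = (\<Union>f\<in>rcset F. fv f)"
  by (simp add: Conj_def cimage.rep_eq)

lemma fv_Disj: "fv (Disj F) = (\<Union>f\<in>rcset F. fv f)"
  by (simp add: cimage.rep_eq)

lemma fv_Imp: "fv (Imp f g) = fv f \<union> fv g"
  by (simp add: Imp_def cimage.rep_eq)

lemma wff_Imp: "wff V (Imp f g) \<longleftrightarrow> wff V f \<and> wff V g \<and> finite (fv f \<union> fv g)"
  by (auto simp: Imp_def cimage.rep_eq)

lemma append_in_tuples:
  "as \<in> tuples M m \<Longrightarrow> bs \<in> tuples M n \<Longrightarrow> as @ bs \<in> tuples M (m + n)"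
  by (auto simp: tuples_def)

lemma tuplesD: "as \<in> tuples M n \<Longrightarrow> length as = n"
  by (simp add: tuples_def)

section \<open>Soundness of finite-length deductions\<close>

text \<open>
  Deductions may use terms with function symbols outside the vocabulary, whose values
  may lie outside the domain. The interpretation is therefore first corrected at these symbols.
\<close>

definition totalize :: "struc \<Rightarrow> struc" where
  "totalize M = M\<lparr>FunI := \<lambda>i as. if FunI M i as \<in> Dom M then FunI M i as else (SOME a. a \<in> Dom M)\<rparr>"

lemma Dom_totalize [simp]: "Dom (totalize M) = Dom M"
  by (simp add: totalize_def)

lemma RelI_totalize [simp]: "RelI (totalize M) = RelI M"
  by (simp add: totalize_def)

lemma FunI_totalize: "Dom M \<noteq> {} \<Longrightarrow> FunI (totalize M) i as \<in> Dom M"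
  by (auto simp: totalize_def some_in_eq)

text \<open>Symbols of the vocabulary map tuples of the domain into the domain, so the correction
  leaves their values there unchanged.\<close>

lemma tm_val_totalize:
  assumes "structure_of V M" "\<And>i. v i \<in> Dom M"
  shows "tm_in V t \<Longrightarrow> tm_val (totalize M) v t = tm_val M v t \<and> tm_val M v t \<in> Dom M"
proof (induction t)
  case (Fn i ts)
  then have "\<forall>t\<in>set ts. tm_val (totalize M) v t = tm_val M v t \<and> tm_val M v t \<in> Dom M"
    by (auto simp: list_all_iff)
  then have eq: "map (tm_val (totalize M) v) ts = map (tm_val M v) ts"
    and args: "map (tm_val M v) ts \<in> lists (Dom M)"
    by auto
  have "\<forall>as\<in>lists (Dom M). length as = length ts \<longrightarrow> FunI M i as \<in> Dom M"
    using assms(1) Fn.prems unfolding structure_of_def by auto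
  then have val: "FunI M i (map (tm_val M v) ts) \<in> Dom M"
    using args by (simp only: length_map)
  then have "FunI (totalize M) i (map (tm_val M v) ts) = FunI M i (map (tm_val M v) ts)"
    by (simp add: totalize_def)
  with val show ?case
    by (simp only: tm_val.simps eq)
qed (use assms in auto)

lemma sat_totalize:
  assumes "structure_of V M"
  shows "wff V f \<Longrightarrow> (\<And>i. v i \<in> Dom M) \<Longrightarrow> sat (totalize M) f v = sat M f v"
proof (induction f arbitrary: v)
  case (Eq s t)
  then show ?case
    using tm_val_totalize[OF assms, of v] by simp
next
  case (Rel i ts)
  then have "map (tm_val (totalize M) v) ts = map (tm_val M v) ts"
    using tm_val_totalize[OF assms, of v] by (auto simp: list_all_iff)
  then show ?case
    by (simp del: map_eq_conv)
next
  case (Ex f)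
  have "sat (totalize M) f (case_nat a v) = sat M f (case_nat a v)" if "a \<in> Dom M" for a
    by (rule Ex.IH) (use Ex.prems that in \<open>auto split: nat.split\<close>)
  then show ?case
    by auto
qed (auto simp: cimage.rep_eq)

text \<open>Totality puts the value of every term, even one outside the vocabulary, into the domain,
  so that the term in \<open>exI\<close> is a legitimate witness.\<close>

lemma derives_sound:
  assumes total: "\<And>i as. FunI M i as \<in> Dom M"
  shows "derives G f \<Longrightarrow> (\<And>i. v i \<in> Dom M) \<Longrightarrow> \<forall>g\<in>G. sat M g v \<Longrightarrow> sat M f v"
proof (induction arbitrary: v rule: derives.induct)
  case (negI f G g)
  then show ?case
    by (metis insert_iff sat.simps(3))
next
  case (negE f G g)
  then show ?case
    by (metis insert_iff sat.simps(3))
next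
  case (disjI f F G)
  then show ?case
    by (auto simp: cimage.rep_eq)
next
  case (disjE F G g)
  have "sat M (Disj F) v"
    using disjE.IH(1) disjE.prems by blast
  then obtain f where "f \<in> rcset F" "sat M f v"
    by (auto simp: cimage.rep_eq)
  then show ?case
    using disjE.IH(2) disjE.prems by simp
next
  case (exI G t f)
  have "tm_val M v t \<in> Dom M"
    using total exI.prems(1) by (cases t) auto
  moreover have "sat M (inst0 t f) v"
    using exI.IH exI.prems by blast
  ultimately show ?case
    by (auto simp: sat_inst0)
next
  case (exE G f g)
  have "sat M (Ex f) v"
    using exE.IH(1) exE.prems by blast
  then obtain a where a: "a \<in> Dom M" "sat M f (case_nat a v)"
    by auto
  have "case_nat a v i \<in> Dom M" for i
    using a exE.prems(1) by (simp split: nat.split)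
  \<comment> \<open>Lifting the premises frees variable 0 for the witness \<open>a\<close>;
    \<open>sat_lift\<close> cancels the shift.\<close>
  then have "sat M (lift g) (case_nat a v)"
    using exE.IH(2)[of "case_nat a v"] a(2) exE.prems(2) by (simp add: sat_lift)
  then show ?case
    by (simp add: sat_lift)
next
  case (eqE G s t f)
  have "sat M (Eq s t) v" "sat M (inst0 s f) v"
    using eqE.IH eqE.prems by blast+
  then show ?case
    by (simp add: sat_inst0)
qed auto

text \<open>\<open>holds\<close> leaves variables beyond the tuple \<open>undefined\<close>,
  possibly outside the domain, while soundness asks for valuations into the domain. Padding with an
  element \<open>d\<close> repairs this without affecting formulas in the first \<open>n\<close>
  variables.\<close>

lemma totalize_valuation:
  assumes "structure_of V M" "as \<in> tuples M n"
  obtains v where "\<And>i. v i \<in> Dom M"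
    and "\<And>g. wff V g \<Longrightarrow> fv g \<subseteq> {..<n} \<Longrightarrow> holds M g as \<longleftrightarrow> sat (totalize M) g v"
proof -
  obtain d where d: "d \<in> Dom M"
    using assms(1) by (auto simp: structure_of_def)
  define v where "v = (\<lambda>i. if i < length as then as ! i else d)"
  have v: "v i \<in> Dom M" for i
    using assms(2) d nth_mem[of i as] by (auto simp: v_def tuples_def)
  have "holds M g as \<longleftrightarrow> sat (totalize M) g v" if "wff V g" "fv g \<subseteq> {..<n}" for g
    using holds_eq_sat[of g as v M] that assms(2) sat_totalize[OF assms(1) _ v]
    by (simp add: v_def tuplesD)
  with v show thesis
    using that by blast
qed

lemma derives_totalize:
  assumes "structure_of V M" "derives G f" "\<And>i. v i \<in> Dom M" "\<forall>g\<in>G. sat (totalize M) g v"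
  shows "sat (totalize M) f v"
proof (rule derives_sound[OF _ assms(2)])
  show "FunI (totalize M) i as \<in> Dom (totalize M)" for i as
    using assms(1) by (simp add: FunI_totalize structure_of_def)
qed (use assms in auto)

lemma derives_holds:
  assumes "structure_of V M" "as \<in> tuples M n"
    and "derives G f" "wff V f" "fv f \<subseteq> {..<n}"
    and G: "\<And>g. g \<in> G \<Longrightarrow> wff V g \<and> fv g \<subseteq> {..<n} \<and> holds M g as"
  shows "holds M f as"
proof -
  obtain v where v: "\<And>i. v i \<in> Dom M"
    and eq: "\<And>g. wff V g \<Longrightarrow> fv g \<subseteq> {..<n} \<Longrightarrow> holds M g as \<longleftrightarrow> sat (totalize M) g v"
    using totalize_valuation[OF assms(1,2)] by blast
  have "sat (totalize M) f v"
    by (rule derives_totalize[OF assms(1,3)]) (use v in simp, use G eq in blast)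
  then show ?thesis
    using eq assms(4,5) by simp
qed

lemma consistent_if_holds:
  assumes "structure_of V M" "as \<in> tuples M n"
    and G: "\<And>g. g \<in> G \<Longrightarrow> wff V g \<and> fv g \<subseteq> {..<n} \<and> holds M g as"
  shows "consistent G"
proof -
  obtain v where v: "\<And>i. v i \<in> Dom M"
    and eq: "\<And>g. wff V g \<Longrightarrow> fv g \<subseteq> {..<n} \<Longrightarrow> holds M g as \<longleftrightarrow> sat (totalize M) g v"
    using totalize_valuation[OF assms(1,2)] by blast
  have sound: "sat (totalize M) f v" if "derives G f" for f
    by (rule derives_totalize[OF assms(1) that]) (use v in simp, use G eq in blast)
  show ?thesis
    unfolding consistent_def using sound sound[of "Neg _"] by (metis sat.simps(3))
qed

section \<open>Types realized in models\<close>

text \<open>These closure conditions pass to intersections and to unions over nonempty index sets,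
  so they hold at the root and at limit levels without showing that the level is a fragment.\<close>

definition literal_closed :: "vocab \<Rightarrow> fm set \<Rightarrow> bool" where
  "literal_closed V L \<longleftrightarrow>
     (\<forall>s t. wff V (Eq s t) \<longrightarrow> Eq s t \<in> L) \<and>
     (\<forall>i ts. wff V (Rel i ts) \<longrightarrow> Rel i ts \<in> L) \<and>
     (\<forall>f\<in>L. Neg f \<in> L) \<and>
     (\<forall>f\<in>L. \<forall>s. (\<forall>i. tm_in V (s i)) \<longrightarrow> subst f s \<in> L)"

lemma fragment_literal_closed: "fragment V L \<Longrightarrow> literal_closed V L"
  by (simp add: fragment_def literal_closed_def)

lemma least_fragment_literal_closed: "literal_closed V (least_fragment V X)"
  unfolding least_fragment_def literal_closed_def by (simp add: fragment_def)

lemma least_fragment_superset: "X \<subseteq> least_fragment V X"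
  by (auto simp: least_fragment_def)

lemma fragment_Exs: "fragment V L \<Longrightarrow> f \<in> L \<Longrightarrow> Exs n f \<in> L"
  unfolding Exs_def by (induction n) (auto simp: fragment_def)

lemma holds_sentence: "models M f \<Longrightarrow> fv f = {} \<Longrightarrow> holds M f as"
  using holds_append[of f "[]" M as] by (simp add: models_def)

lemma tp_mono_eq:
  assumes "L' \<subseteq> L" "tp L M as = tp L N bs"
  shows "tp L' M as = tp L' N bs"
proof -
  have "tp L' K cs = tp L K cs \<inter> L'" for K cs
    using assms(1) by (auto simp: tp_def)
  then show ?thesis
    by (simp add: assms(2))
qed

lemma tp_consistent:
  assumes "models_all V M S" "as \<in> tuples M n"
    and "\<And>f. f \<in> L \<Longrightarrow> wff V f" "\<And>f. f \<in> S \<Longrightarrow> wff V f \<and> fv f = {}"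
  shows "consistent (S \<union> tp L M as)"
proof (rule consistent_if_holds[OF _ assms(2)])
  show "structure_of V M"
    using assms(1) by (simp add: models_all_def)
  fix f assume "f \<in> S \<union> tp L M as"
  then show "wff V f \<and> fv f \<subseteq> {..<n} \<and> holds M f as"
    using assms holds_sentence by (auto simp: tp_def models_all_def tuplesD)
qed

text \<open>By soundness the type of the realizer is consistent with \<open>S\<close>; it contains
  \<open>p\<close>, so maximality of \<open>p\<close> forces equality.\<close>

lemma tp_eq_ntype:
  assumes "models_all V M S" "ntype L S n p" "realizes M n as p"
    and "\<And>f. f \<in> L \<Longrightarrow> wff V f" "\<And>f. f \<in> S \<Longrightarrow> wff V f \<and> fv f = {}"
  shows "tp L M as = p"
proof -
  have as: "as \<in> tuples M n"
    using assms(3) by (simp add: realizes_def)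
  have "p \<subseteq> tp L M as" "tp L M as \<subseteq> {f \<in> L. fv f \<subseteq> {..<n}}"
    using assms(2,3) as by (auto simp: ntype_def realizes_def tp_def tuplesD)
  moreover have "consistent (S \<union> tp L M as)"
    by (rule tp_consistent[OF assms(1) as]) (use assms(4,5) in auto)
  ultimately show ?thesis
    using assms(2) unfolding ntype_def by blast
qed

text \<open>Consistency is soundness at \<open>as\<close>; maximality holds because every omitted
  formula has its negation in the type.\<close>

lemma tp_ntype:
  assumes "models_all V M S" "as \<in> tuples M n" "literal_closed V L"
    and "\<And>f. f \<in> L \<Longrightarrow> wff V f" "\<And>f. f \<in> S \<Longrightarrow> wff V f \<and> fv f = {}"
  shows "ntype L S n (tp L M as)"
  unfolding ntype_def
proof (intro conjI allI impI)
  show "tp L M as \<subseteq> {f \<in> L. fv f \<subseteq> {..<n}}"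
    using assms(2) by (auto simp: tp_def tuplesD)
  show "consistent (S \<union> tp L M as)"
    by (rule tp_consistent) (use assms in auto)
  fix p' assume p': "tp L M as \<subseteq> p' \<and> p' \<subseteq> {f \<in> L. fv f \<subseteq> {..<n}} \<and> consistent (S \<union> p')"
  have "f \<in> tp L M as" if f: "f \<in> p'" for f
  proof (rule ccontr)
    assume "f \<notin> tp L M as"
    then have "Neg f \<in> tp L M as"
      using f p' assms(2,3) by (auto simp: tp_def tuplesD literal_closed_def)
    then have "derives (S \<union> p') f" "derives (S \<union> p') (Neg f)"
      using f p' by (auto intro: assm)
    with p' show False
      by (auto simp: consistent_def)
  qed
  with p' show "p' = tp L M as"
    by blast
qed

text \<open>A formula only on the right would put its negation on the left, hence also on the
  right.\<close>

lemma tp_eqI: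
  assumes "literal_closed V L" "length as = length bs" "tp L M as \<subseteq> tp L N bs"
  shows "tp L M as = tp L N bs"
proof
  show "tp L N bs \<subseteq> tp L M as"
  proof (rule ccontr)
    assume "\<not> tp L N bs \<subseteq> tp L M as"
    then obtain f where f: "f \<in> tp L N bs" "f \<notin> tp L M as"
      by auto
    then have "Neg f \<in> tp L M as"
      using assms(1,2) by (auto simp: tp_def literal_closed_def)
    with assms(3) have "Neg f \<in> tp L N bs"
      by blast
    with f(1) show False
      by (simp add: tp_def)
  qed
qed (fact assms(3))

text \<open>Passing to the subtuple listed by \<open>r\<close> is a renaming of variables, and
  \<open>L\<close> is closed under substitution.\<close>

lemma tp_reindex:
  assumes L: "literal_closed V L" and len: "length as = length bs"
    and eq: "tp L M as = tp L N bs" and r: "set r \<subseteq> {..<length as}"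
  shows "tp L M (map ((!) as) r) = tp L N (map ((!) bs) r)"
proof (rule tp_eqI[OF L])
  \<comment> \<open>The index \<open>0\<close> beyond \<open>length r\<close> is a default: the
    formulas concerned have their free variables below \<open>length r\<close>.\<close>
  let ?s = "\<lambda>i. Var (if i < length r then r ! i else 0)"
  have holds: "holds K (subst f ?s) cs \<longleftrightarrow> holds K f (map ((!) cs) r)"
    if "fv f \<subseteq> {..<length r}" "length cs = length as" for K f and cs :: "nat list"
  proof -
    have "r ! i < length cs" if "i < length r" for i
      using r nth_mem[OF that] \<open>length cs = length as\<close> by auto
    with that(1) show ?thesis
      unfolding holds_def sat_subst by (intro sat_cong) auto
  qed
  show "tp L M (map ((!) as) r) \<subseteq> tp L N (map ((!) bs) r)"
  proof
    fix f assume f: "f \<in> tp L M (map ((!) as) r)"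
    then have fv: "fv f \<subseteq> {..<length r}"
      by (simp add: tp_def)
    have "(\<Union>i\<in>fv f. tm_vars (?s i)) \<subseteq> {..<length as}"
      using fv r nth_mem[of _ r] by (auto simp: subset_iff)
    then have "fv (subst f ?s) \<subseteq> {..<length as}"
      using fv_subst[of f ?s] by (rule order_trans[rotated])
    moreover have "subst f ?s \<in> L"
      using L f by (simp add: literal_closed_def tp_def)
    ultimately have "subst f ?s \<in> tp L M as"
      using f holds[OF fv] by (simp add: tp_def)
    then have "subst f ?s \<in> tp L N bs"
      by (simp add: eq)
    then show "f \<in> tp L N (map ((!) bs) r)"
      using f fv holds[OF fv] len by (simp add: tp_def)
  qed
qed simp

text \<open>Only atomic formulas are read off from the type; induction handles the connectives, so
  \<open>f\<close> may lie outside \<open>L\<close>. This is the base level of the transfer along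
  the branch.\<close>

lemma qfree_transfer:
  assumes L: "literal_closed V L" and len: "length as = length bs"
    and eq: "tp L M as = tp L N bs"
  shows "qfree f \<Longrightarrow> wff V f \<Longrightarrow> fv f \<subseteq> {..<length as} \<Longrightarrow> holds M f as \<longleftrightarrow> holds N f bs"
proof (induction f)
  case (Eq s t)
  then have "Eq s t \<in> tp L M as \<longleftrightarrow> holds M (Eq s t) as" "Eq s t \<in> tp L N bs \<longleftrightarrow> holds N (Eq s t) bs"
    using L len by (auto simp: literal_closed_def tp_def)
  with eq show ?case
    by simp
next
  case (Rel i ts)
  then have "Rel i ts \<in> tp L M as \<longleftrightarrow> holds M (Rel i ts) as"
    "Rel i ts \<in> tp L N bs \<longleftrightarrow> holds N (Rel i ts) bs"
    using L len by (auto simp: literal_closed_def tp_def)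
  with eq show ?case
    by simp
next
  case (Disj F)
  have "holds M f as \<longleftrightarrow> holds N f bs" if "f \<in> rcset F" for f
    by (rule Disj.IH[OF that]) (use Disj.prems that in \<open>auto simp: cimage.rep_eq\<close>)
  then show ?case
    by (auto simp: holds_Disj)
qed auto

section \<open>Back and forth along a branch\<close>

locale node_branch =
  fixes V phi L T
  assumes branch: "branch V phi L T"
begin

section \<open>Monotonicity and closure of the levels of the branch\<close>

lemma node_L: "node V phi d (L d) (T d)"
  and child: "child_node V (L d) (T d) (L (osuc d)) (T (osuc d))"
  using branch by (auto simp: branch_def)

lemma fragment_osuc: "fragment V (L (osuc d))"
  and L_osuc: "L (osuc d) = next_fragment V (L d) (T d)"
  and T_le_osuc: "T d \<subseteq> T (osuc d)"
  using child[of d] by (auto simp: child_node_def)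

lemma L_le_osuc: "L d \<subseteq> L (osuc d)"
  using least_fragment_superset unfolding L_osuc next_fragment_def by blast

lemma L_T_mono: "c \<le> d \<Longrightarrow> L c \<subseteq> L d \<and> T c \<subseteq> T d"
proof (induction d rule: less_induct)
  case (less d)
  consider "c = d" | "c < d"
    using less.prems by (auto simp: le_less)
  then show ?case
  proof cases
    case 2
    show ?thesis
    proof (cases rule: w1_cases[of d])
      case (2 e)
      have "c \<le> e"
      proof (rule ccontr)
        assume "\<not> c \<le> e"
        then have "osuc e \<le> c"
          by (simp add: osuc_le)
        with \<open>d = osuc e\<close> \<open>c < d\<close> show False
          by simp
      qed
      with less.IH[OF \<open>e < d\<close>] L_le_osuc[of e] T_le_osuc[of e] \<open>d = osuc e\<close> show ?thesis
        by blast
    next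
      case 3
      then have "L d = (\<Union>d\<in>{c. c < d}. L d)" "T d = (\<Union>d\<in>{c. c < d}. T d)"
        using branch unfolding branch_def by blast+
      with \<open>c < d\<close> show ?thesis
        by blast
    qed (use \<open>c < d\<close> in simp)
  qed simp
qed

lemma L_zero: "L o0 = L_zero V phi"
  using node_L[of o0]
proof cases
  case node_zero
  then show ?thesis
    by (simp add: root_node_def)
next
  case (node_suc d)
  then show ?thesis
    using osuc_neq_o0 by metis
next
  case node_limit
  then show ?thesis
    by (simp add: olimit_def)
qed

lemma L_literal_closed: "literal_closed V (L d)"
proof (induction d rule: less_induct)
  case (less d)
  show ?case
  proof (cases rule: w1_cases[of d])
    case 1
    then show ?thesis
      by (simp add: L_zero L_zero_def least_fragment_literal_closed)
  next
    case (2 c)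
    then show ?thesis
      using fragment_literal_closed fragment_osuc by simp
  next
    case 3
    then have "L d = (\<Union>d\<in>{c. c < d}. L d)"
      using branch unfolding branch_def by blast
    \<comment> \<open>The union over the levels below \<open>d\<close> is thus nonempty, which
      closure under atomic formulas requires.\<close>
    moreover have "o0 < d"
      using 3 by (simp add: olimit_def o0_less)
    moreover have "literal_closed V (\<Union>c\<in>I. L c)" if "i \<in> I" "\<forall>c\<in>I. literal_closed V (L c)" for i I
      using that unfolding literal_closed_def by (simp, blast)
    ultimately show ?thesis
      using less by simp
  qed
qed

text \<open>\<open>child_node\<close> supplies the fragment property for \<open>L (osuc d)\<close>,
  and level \<open>d\<close> lies inside it.\<close>

lemma L_wff: "f \<in> L d \<Longrightarrow> wff V f"
  using fragment_osuc[of d] L_le_osuc[of d] by (auto simp: fragment_def)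

lemma T_sentence: "f \<in> T d \<Longrightarrow> wff V f \<and> fv f = {}"
proof -
  assume "f \<in> T d"
  then have "f \<in> {f \<in> L (osuc d). fv f = {}}"
    using child[of d] unfolding child_node_def omega_complete_def by blast
  then show ?thesis
    using L_wff by blast
qed

lemma models_T_mono: "models_all V M (T d) \<Longrightarrow> c \<le> d \<Longrightarrow> models_all V M (T c)"
  using L_T_mono[of c d] by (auto simp: models_all_def)

section \<open>Extending matched tuples\<close>

lemma forth:
  assumes M: "models_all V M (T d)" and N: "models_all V N (T d)"
    and as: "as \<in> tuples M m" and bs: "bs \<in> tuples N m"
    and eq: "tp (L (osuc d)) M as = tp (L (osuc d)) N bs"
    and cs: "cs \<in> tuples M k"
  obtains ds where "ds \<in> tuples N k" "tp (L d) M (cs @ as) = tp (L d) N (ds @ bs)"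
proof -
  define p where "p = tp (L d) M (cs @ as)"
  have cas: "cs @ as \<in> tuples M (k + m)"
    using append_in_tuples cs as by blast
  have p: "ntype (L d) (T d) (k + m) p"
    unfolding p_def by (rule tp_ntype[OF M cas L_literal_closed]) (use L_wff T_sentence in auto)
  \<comment> \<open>Quantifying away the first \<open>k\<close> variables of a formula of the next
    level leaves a formula about the base tuple alone, on which \<open>as\<close> and
    \<open>bs\<close> agree.\<close>
  have transfer: "\<exists>ds\<in>tuples N k. holds N f (ds @ bs)"
    if "f \<in> L (osuc d)" "fv f \<subseteq> {..<k + m}" "holds M f (cs @ as)" for f
  proof -
    have "Exs k f \<in> tp (L (osuc d)) M as"
      using that cs as fragment_Exs[OF fragment_osuc]
      by (auto simp: tp_def holds_Exs fv_Exs tuplesD fv_shift_subset)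
    then have "Exs k f \<in> tp (L (osuc d)) N bs"
      by (simp add: eq)
    then have "holds N (Exs k f) bs"
      by (simp add: tp_def)
    then show ?thesis
      by (simp add: holds_Exs)
  qed
  have "\<exists>ds\<in>tuples N k. \<forall>g\<in>p. holds N g (ds @ bs)"
  proof (cases "principal (T d) (k + m) p")
    case True
    then obtain f where f: "f \<in> p" "\<forall>g\<in>p. derives (T d) (Alls (k + m) (Imp f g))"
      by (auto simp: principal_def)
    have pD: "g \<in> L d" "fv g \<subseteq> {..<k + m}" "holds M g (cs @ as)" if "g \<in> p" for g
      using that tuplesD[OF cas] by (auto simp: p_def tp_def)
    obtain ds where ds: "ds \<in> tuples N k" "holds N f (ds @ bs)"
      using transfer[of f] pD[OF f(1)] L_le_osuc by blast
    \<comment> \<open>\<open>T d\<close> derives that the generator \<open>f\<close> implies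
      \<open>g\<close>, and \<open>N\<close> is a model of \<open>T d\<close>, so soundness turns a
      realizer of \<open>f\<close> into a realizer of all of \<open>p\<close>.\<close>
    have "holds N g (ds @ bs)" if g: "g \<in> p" for g
    proof -
      have wff: "wff V (Imp f g)" and fv: "fv (Imp f g) \<subseteq> {..<k + m}"
        using pD[OF f(1)] pD[OF g] L_wff finite_subset[OF _ finite_lessThan]
        by (simp_all add: wff_Imp fv_Imp)
      have "holds N (Alls (k + m) (Imp f g)) []"
      proof (rule derives_holds[of V N "[]" 0 "T d"])
        show "structure_of V N"
          using N by (simp add: models_all_def)
        show "derives (T d) (Alls (k + m) (Imp f g))"
          using f g by blast
        show "wff V (Alls (k + m) (Imp f g))"
          using wff by simp
        show "fv (Alls (k + m) (Imp f g)) \<subseteq> {..<0}"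
          unfolding fv_Alls fv_shift_subset using fv by simp
        show "\<And>g. g \<in> T d \<Longrightarrow> wff V g \<and> fv g \<subseteq> {..<0} \<and> holds N g []"
          using N T_sentence by (auto simp: models_all_def models_def)
      qed (simp add: tuples_def)
      then have "holds N (Imp f g) (ds @ bs)"
        using append_in_tuples[OF ds(1) bs] by (auto simp: holds_Alls)
      with ds(2) show ?thesis
        by simp
    qed
    with ds(1) show ?thesis
      by blast
  next
    case False
    \<comment> \<open>The elements of \<open>acset p\<close> are known to be those of
      \<open>p\<close> once \<open>p\<close> is countable.\<close>
    have "countable (L d)"
      using fragment_osuc[of d] L_le_osuc[of d] by (auto simp: fragment_def intro: countable_subset)
    then have "countable p"
      by (rule countable_subset[rotated]) (auto simp: p_def tp_def)
    then have rc: "rcset (acset p) = p"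
      by (simp add: acset_inverse)
    have "Conj (acset p) \<in> L (osuc d)"
      unfolding L_osuc next_fragment_def
      by (rule subsetD[OF least_fragment_superset], rule UnI2) (use p False in blast)
    moreover have "fv (Conj (acset p)) \<subseteq> {..<k + m}" "holds M (Conj (acset p)) (cs @ as)"
      unfolding fv_Conj holds_Conj rc using tuplesD[OF cas] by (auto simp: p_def tp_def)
    ultimately show ?thesis
      using transfer[of "Conj (acset p)"] by (simp add: holds_Conj rc)
  qed
  then obtain ds where ds: "ds \<in> tuples N k" "\<forall>g\<in>p. holds N g (ds @ bs)"
    by blast
  have len: "length (cs @ as) = length (ds @ bs)"
    using as bs cs ds(1) by (simp add: tuplesD)
  have "tp (L d) M (cs @ as) \<subseteq> tp (L d) N (ds @ bs)"
    using ds(2) len by (auto simp: p_def tp_def)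
  then have "tp (L d) M (cs @ as) = tp (L d) N (ds @ bs)"
    by (rule tp_eqI[OF L_literal_closed len])
  with ds(1) show thesis
    using that by blast
qed

text \<open>From \<open>c < d\<close> follows \<open>osuc c \<le> d\<close>, so agreement at level
  \<open>d\<close>, limit or not, includes the one extra level that \<open>forth\<close>
  consumes.\<close>

lemma forth_below:
  assumes "c < d" "models_all V M (T d)" "models_all V N (T d)"
    and "as \<in> tuples M m" "bs \<in> tuples N m" "tp (L d) M as = tp (L d) N bs" "cs \<in> tuples M k"
  obtains ds where "ds \<in> tuples N k" "tp (L c) M (cs @ as) = tp (L c) N (ds @ bs)"
proof (rule forth[of M c N as m bs cs k])
  show "tp (L (osuc c)) M as = tp (L (osuc c)) N bs"
    using tp_mono_eq[OF _ assms(6)] L_T_mono[OF osuc_le[OF assms(1)]] by simp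
qed (use assms models_T_mono[of _ d c] that in auto)

section \<open>Transfer of \<Sigma> and \<Pi> formulas between models\<close>

text \<open>Induction on the level. The witnesses of a quantifier block are matched by
  \<open>forth_below\<close> down to the strictly lower level of the matrix, where the induction
  hypothesis applies. \<Sigma> and \<Pi> go together because each matrix belongs to the opposite
  class.\<close>

lemma Sigma_Pi_transfer:
  "(is_Sigma a f \<or> is_Pi a f) \<Longrightarrow> wff V f \<Longrightarrow> fv f \<subseteq> {..<m} \<Longrightarrow>
   models_all V M (T a) \<Longrightarrow> models_all V N (T a) \<Longrightarrow> as \<in> tuples M m \<Longrightarrow> bs \<in> tuples N m \<Longrightarrow>
   tp (L a) M as = tp (L a) N bs \<Longrightarrow> holds M f as \<longleftrightarrow> holds N f bs"
proof (induction a arbitrary: f m M N as bs rule: less_induct)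
  case (less a)
  have IH: "holds M h (cs @ as) \<longleftrightarrow> holds N h (ds @ bs)"
    if "c < a" "is_Sigma c h \<or> is_Pi c h" "wff V h" "{i. i + n \<in> fv h} \<subseteq> {..<m}"
      "cs \<in> tuples M n" "ds \<in> tuples N n" "tp (L c) M (cs @ as) = tp (L c) N (ds @ bs)"
    for c n h cs ds
    using that(4) less.IH[OF that(1-3), of "n + m" M N "cs @ as" "ds @ bs"] that less.prems
      models_T_mono[of _ a c] append_in_tuples fv_shift_subset[of n "fv h" m] by force
  have forth: "\<exists>ds\<in>tuples N n. tp (L c) M (cs @ as) = tp (L c) N (ds @ bs)"
    if "c < a" "cs \<in> tuples M n" for c n cs
    using forth_below[OF that(1) less.prems(4-8) that(2)] by blast
  \<comment> \<open>The same with the two models exchanged: witnesses in \<open>N\<close> are pulled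
    back to \<open>M\<close>.\<close>
  have backward: "\<exists>cs\<in>tuples M n. tp (L c) M (cs @ as) = tp (L c) N (ds @ bs)"
    if "c < a" "ds \<in> tuples N n" for c n ds
    using forth_below[OF that(1) less.prems(5,4,7,6) less.prems(8)[symmetric] that(2)] by metis
  have quantified: "holds M (Exs n h) as \<longleftrightarrow> holds N (Exs n h) bs"
    "holds M (Alls n h) as \<longleftrightarrow> holds N (Alls n h) bs"
    if "c < a" "is_Sigma c h \<or> is_Pi c h" "wff V h" "{i. i + n \<in> fv h} \<subseteq> {..<m}" for n h c
    unfolding holds_Exs holds_Alls
    using IH[OF that] forth[OF that(1)] backward[OF that(1)] by meson+
  have qf: "holds M f as \<longleftrightarrow> holds N f bs" if "qfree f"
    using qfree_transfer[OF L_literal_closed _ less.prems(8) that less.prems(2)] less.prems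
    by (simp add: tuplesD)
  from less.prems(1) show ?case
  proof
    assume "is_Sigma a f"
    then show ?case
    proof cases
      case (Sigma_pos F)
      have "holds M g as \<longleftrightarrow> holds N g bs" if g: "g \<in> rcset F" for g
      proof -
        obtain n h b where "g = Exs n h" "b < a" "is_Pi b h"
          using Sigma_pos g by blast
        then show ?thesis
          using quantified(1)[of b h n] less.prems(2,3) wff_Disj[of V F g] g Sigma_pos(1)
          by (auto simp: fv_Disj fv_Exs UN_subset_iff simp del: wff.simps fv.simps)
      qed
      then show ?thesis
        by (simp add: Sigma_pos holds_Disj)
    qed (rule qf)
  next
    assume "is_Pi a f"
    then show ?case
    proof cases
      case (Pi_pos F)
      have "holds M g as \<longleftrightarrow> holds N g bs" if g: "g \<in> rcset F" for g
      proof -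
        obtain n h b where "g = Alls n h" "b < a" "is_Sigma b h"
          using Pi_pos g by blast
        then show ?thesis
          using quantified(2)[of b h n] less.prems(2,3) wff_Conj[of V F g] g Pi_pos(1)
          by (auto simp: fv_Conj fv_Alls UN_subset_iff simp del: wff.simps fv.simps)
      qed
      then show ?thesis
        by (simp add: Pi_pos holds_Conj)
    qed (rule qf)
  qed
qed

text \<open>Cuts a block out of a concatenation by an index list, the form in which
  \<open>tp_reindex\<close> takes subtuples.\<close>

lemma map_nth_middle: "map ((!) (xs @ ys @ zs)) [length xs..<length xs + length ys] = ys"
  by (rule nth_equalityI) (auto simp: nth_append)

text \<open>That some tuple satisfies \<open>f\<close> but not \<open>g\<close> is a
  \<open>\<Sigma>\<^sub>a\<close> statement up to equivalence, though not syntactically. One true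
  disjunct of \<open>f\<close> and one false conjunct of \<open>g\<close> witness it, both with
  matrices of levels below \<open>a\<close>, so a single extension of the matched tuples
  \<open>as\<close> and \<open>bs\<close> suffices.\<close>

lemma exists_Sigma_and_not_Pi_transfer:
  assumes M: "models_all V M (T a)" and N: "models_all V N (T a)"
    and as: "as \<in> tuples M m" and bs: "bs \<in> tuples N m"
    and eq: "tp (L a) M as = tp (L a) N bs" and "a \<noteq> o0"
    and f: "f \<in> Sigma_in V a" "fv f \<subseteq> {..<n}"
    and g: "g \<in> Pi_in V a" "fv g \<subseteq> {..<n}"
    and cs: "cs \<in> tuples M n" "holds M f cs" "\<not> holds M g cs"
  obtains ds where "ds \<in> tuples N n" "holds N f ds" "\<not> holds N g ds"
proof -
  from f(1) have "is_Sigma a f"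
    by (simp add: Sigma_in_def)
  then obtain F where F: "f = Disj F"
    "\<And>f'. f' \<in> rcset F \<Longrightarrow> \<exists>j h b. f' = Exs j h \<and> b < a \<and> is_Pi b h"
    using \<open>a \<noteq> o0\<close> by cases auto
  from g(1) have "is_Pi a g"
    by (simp add: Pi_in_def)
  then obtain F' where F': "g = Conj F'"
    "\<And>f'. f' \<in> rcset F' \<Longrightarrow> \<exists>j h b. f' = Alls j h \<and> b < a \<and> is_Sigma b h"
    using \<open>a \<noteq> o0\<close> by cases auto
  obtain j h b where h: "Exs j h \<in> rcset F" "b < a" "is_Pi b h" "holds M (Exs j h) cs"
    using F cs(2) by (metis holds_Disj)
  obtain j' h' b' where h': "Alls j' h' \<in> rcset F'" "b' < a" "is_Sigma b' h'" "\<not> holds M (Alls j' h') cs"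
    using F' cs(3) by (metis holds_Conj)
  have wff: "wff V h" "wff V h'"
    using f(1) g(1) wff_Disj[of V F "Exs j h"] wff_Conj[of V F' "Alls j' h'"] h h' F(1) F'(1)
    by (auto simp: Sigma_in_def Pi_in_def simp del: wff.simps)
  have "fv (Exs j h) \<subseteq> {..<n}" "fv (Alls j' h') \<subseteq> {..<n}"
    using f(2) g(2) h(1) h'(1) F(1) F'(1) by (auto simp: fv_Disj fv_Conj simp del: fv.simps)
  then have fv: "fv h \<subseteq> {..<j + n}" "fv h' \<subseteq> {..<j' + n}"
    by (simp_all only: fv_Exs fv_Alls fv_shift_subset)
  obtain us where us: "us \<in> tuples M j" "holds M h (us @ cs)"
    using h(4) by (auto simp: holds_Exs)
  obtain us' where us': "us' \<in> tuples M j'" "\<not> holds M h' (us' @ cs)"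
    using h'(4) by (auto simp: holds_Alls)
  \<comment> \<open>The larger of the two levels is still below \<open>a\<close>, so it can serve
    both matrices at once.\<close>
  define c where "c = max b b'"
  have c: "c < a" "b \<le> c" "b' \<le> c"
    using h(2) h'(2) by (auto simp: c_def)
  \<comment> \<open>Both groups of witnesses are joined with \<open>cs\<close> into one tuple;
    separate extensions could produce different counterparts of \<open>cs\<close>.\<close>
  have ext: "us' @ us @ cs \<in> tuples M (j' + (j + n))"
    using append_in_tuples us(1) us'(1) cs(1) by blast
  obtain ws where ws: "ws \<in> tuples N (j' + (j + n))"
    and eq_c: "tp (L c) M ((us' @ us @ cs) @ as) = tp (L c) N (ws @ bs)"
    using forth_below[OF c(1) M N as bs eq ext] by blast
  \<comment> \<open>\<open>ws\<close> is cut at the lengths of \<open>us'\<close>, \<open>us\<close>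
    and \<open>cs\<close>.\<close>
  define vs' where "vs' = take j' ws"
  define vs where "vs = take j (drop j' ws)"
  define ds where "ds = drop j (drop j' ws)"
  have ws_eq: "ws = vs' @ vs @ ds"
    unfolding vs'_def vs_def ds_def by (simp del: drop_drop)
  have vs: "vs' \<in> tuples N j'" "vs \<in> tuples N j" "ds \<in> tuples N n"
    using ws by (auto simp: tuples_def vs'_def vs_def ds_def dest!: in_set_takeD in_set_dropD)
  note len = tuplesD[OF us(1)] tuplesD[OF us'(1)] tuplesD[OF cs(1)] tuplesD[OF as] tuplesD[OF bs]
    vs[THEN tuplesD]
  text \<open>The two matrices have different bound variables in front of the common ones, so each needs
    its own subtuple of the joint extension.\<close>
  have eq_c': "tp (L c) M (map ((!) (us' @ us @ cs @ as)) r) =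
      tp (L c) N (map ((!) (vs' @ vs @ ds @ bs)) r)"
    if "\<And>i. i \<in> set r \<Longrightarrow> i < j' + (j + n)" for r
  proof (rule tp_reindex[OF L_literal_closed])
    show "length (us' @ us @ cs @ as) = length (vs' @ vs @ ds @ bs)"
      using len by simp
    show "tp (L c) M (us' @ us @ cs @ as) = tp (L c) N (vs' @ vs @ ds @ bs)"
      using eq_c unfolding ws_eq by simp
    show "set r \<subseteq> {..<length (us' @ us @ cs @ as)}"
      using that len by fastforce
  qed
  \<comment> \<open>The first index list skips \<open>xs'\<close>, the second skips
    \<open>xs\<close>; the trailing \<open>zs\<close> stands for \<open>as\<close> or
    \<open>bs\<close> and is dropped by both.\<close>
  have sub: "map ((!) (xs' @ xs @ ys @ zs)) [j'..<j' + (j + n)] = xs @ ys"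
    "map ((!) (xs' @ xs @ ys @ zs)) ([0..<j'] @ [j' + j..<j' + j + n]) = xs' @ ys"
    if "length xs' = j'" "length xs = j" "length ys = n" for xs' xs ys zs :: "nat list"
    using map_nth_middle[of xs' "xs @ ys" zs] map_nth_middle[of "[]" xs' "xs @ ys @ zs"]
      map_nth_middle[of "xs' @ xs" ys zs] that by simp_all
  have "tp (L c) M (us @ cs) = tp (L c) N (vs @ ds)"
    using eq_c'[of "[j'..<j' + (j + n)]"]
    unfolding sub(1)[OF len(2,1,3)] sub(1)[OF len(6-8)] by auto
  then have "tp (L b) M (us @ cs) = tp (L b) N (vs @ ds)"
    by (rule tp_mono_eq[rotated]) (use L_T_mono[OF c(2)] in simp)
  then have "holds N h (vs @ ds)"
    using Sigma_Pi_transfer[of b h "j + n" M N "us @ cs" "vs @ ds"] h us wff fv vs cs(1)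
      append_in_tuples models_T_mono[of _ a b] M N by simp
  then have "holds N (Exs j h) ds"
    using vs(2) by (auto simp: holds_Exs)
  then have "holds N f ds"
    using h(1) F(1) by (auto simp: holds_Disj)
  have "tp (L c) M (us' @ cs) = tp (L c) N (vs' @ ds)"
    using eq_c'[of "[0..<j'] @ [j' + j..<j' + j + n]"]
    unfolding sub(2)[OF len(2,1,3)] sub(2)[OF len(6-8)] by (simp, linarith)
  then have "tp (L b') M (us' @ cs) = tp (L b') N (vs' @ ds)"
    by (rule tp_mono_eq[rotated]) (use L_T_mono[OF c(3)] in simp)
  then have "\<not> holds N h' (vs' @ ds)"
    using Sigma_Pi_transfer[of b' h' "j' + n" M N "us' @ cs" "vs' @ ds"] h' us' wff fv vs cs(1)
      append_in_tuples models_T_mono[of _ a b'] M N by simp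
  then have "\<not> holds N (Alls j' h') ds"
    using vs(1) by (auto simp: holds_Alls)
  then have "\<not> holds N g ds"
    using h'(1) F'(1) by (auto simp: holds_Conj)
  with \<open>holds N f ds\<close> vs(3) show thesis
    using that by blast
qed

end

section \<open>Transfer of the support between fiber models\<close>

theorem mainTheorem10:
  fixes V :: vocab and phi :: fm
    and L T :: "w1 \<Rightarrow> fm set" and A B :: "w1 \<Rightarrow> struc" and C :: "w1 set"
    and l :: w1 and M M' :: struc and n :: nat and q G :: "fm set" and theta :: fm
  assumes "minimal_counterexample V phi"
    and "sacks_data V phi L T A C B"
    and "l \<in> S_circ V phi C"
    and "fiber_model V T l M" and "fiber_model V T l M'"
    and "ntype (L l) (T l) n q"
    and "\<exists>as. realizes M n as q" and "\<exists>as. realizes M' n as q"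
    and "G = Phi V l M n q"
    and "supports V l M n theta G"
  shows "Phi V l M' n q = G \<and> supports V l M' n theta G"
proof -
  interpret node_branch V phi L T
    by unfold_locales (use assms(2) in \<open>simp add: sacks_data_def\<close>)
  \<comment> \<open>Every ordinal in \<open>C\<close> exceeds \<open>oomega\<close>, hence is not
    zero.\<close>
  have "l \<noteq> o0"
    using assms(2,3) unfolding sacks_data_def S_circ_def by (metis Int_iff not_less_o0)
  have M: "models_all V M (T l)" and M': "models_all V M' (T l)"
    using assms(4,5) by (simp_all add: fiber_model_def)
  \<comment> \<open>These are the realizers chosen in the definition of \<open>Phi\<close>, so its
    two values are the \<Pi>-types of \<open>as\<close> and \<open>bs\<close>.\<close>
  define as where "as = (SOME as. realizes M n as q)"
  define bs where "bs = (SOME bs. realizes M' n bs q)"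
  have "realizes M n as q" "realizes M' n bs q"
    unfolding as_def bs_def using someI_ex[OF assms(7)] someI_ex[OF assms(8)] by auto
  then have as: "as \<in> tuples M n" and bs: "bs \<in> tuples M' n"
    and tp_as: "tp (L l) M as = q" and tp_bs: "tp (L l) M' bs = q"
    using tp_eq_ntype[OF M assms(6)] tp_eq_ntype[OF M' assms(6)] L_wff T_sentence
    by (auto simp: realizes_def)
  then have eq: "tp (L l) M as = tp (L l) M' bs"
    by simp
  have "Pi_type V l M as = Pi_type V l M' bs"
    using Sigma_Pi_transfer[OF _ _ _ M M' as bs eq] as bs
    by (auto simp: Pi_type_def Pi_in_def tuplesD)
  then have Phi: "Phi V l M' n q = G"
    using assms(9) by (simp add: Phi_def as_def bs_def)
  have theta: "theta \<in> Sigma_in V l" "fv theta \<subseteq> {..<n}" "models M (Exs n theta)"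
    and sup: "\<And>g. g \<in> G \<Longrightarrow> models M (Alls n (Imp theta g))"
    using assms(10) by (auto simp: supports_def)
  have "models M' (Exs n theta)"
  proof -
    obtain cs where cs: "cs \<in> tuples M n" "holds M theta cs"
      using theta(3) by (auto simp: models_def holds_Exs)
    \<comment> \<open>\<open>no\<close> is a \<open>\<Pi>\<^sub>l\<close> formula that no tuple
      satisfies: its sole conjunct is the empty disjunction. Put in place of \<open>g\<close>, it
      makes the transfer lemma move a realizer of \<open>theta\<close> alone.\<close>
    define no where "no = Conj (acset {Disj (acset {})})"
    have rc: "rcset (acset {}) = {}" "rcset (acset {f}) = {f}" for f :: fm
      by (simp_all add: acset_inverse)
    have "is_Sigma o0 (Disj (acset {}))"
      by (rule Sigma_zero) (simp_all add: rc cimage.rep_eq)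
    moreover have "o0 < l"
      using \<open>l \<noteq> o0\<close> by (rule o0_less)
    \<comment> \<open>Written as an empty block of universal quantifiers to fit the rule
      \<open>Pi_pos\<close>.\<close>
    moreover have "Disj (acset {}) = Alls 0 (Disj (acset {}))"
      by (simp add: Alls_def)
    ultimately have "is_Pi l no"
      unfolding no_def by (intro Pi_pos) (simp_all only: rc, blast+)
    then have "no \<in> Pi_in V l" "fv no \<subseteq> {..<n}" "\<not> holds M no cs"
      by (auto simp: Pi_in_def no_def Conj_def holds_Disj rc cimage.rep_eq)
    then obtain ds where "ds \<in> tuples M' n" "holds M' theta ds"
      using exists_Sigma_and_not_Pi_transfer[OF M M' as bs eq \<open>l \<noteq> o0\<close> theta(1,2) _ _ cs] by blast
    then show ?thesis
      by (auto simp: models_def holds_Exs)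
  qed
  moreover have "models M' (Alls n (Imp theta g))" if "g \<in> G" for g
  proof (rule ccontr)
    assume "\<not> models M' (Alls n (Imp theta g))"
    then obtain ds where ds: "ds \<in> tuples M' n" "holds M' theta ds" "\<not> holds M' g ds"
      by (auto simp: models_def holds_Alls)
    have "g \<in> Pi_in V l" "fv g \<subseteq> {..<n}"
      using \<open>g \<in> G\<close> assms(9) as by (auto simp: Phi_def Pi_type_def as_def tuplesD)
    then obtain cs where "cs \<in> tuples M n" "holds M theta cs" "\<not> holds M g cs"
      \<comment> \<open>The roles of the models are exchanged: a counterexample to the support in
        \<open>M'\<close> is moved to \<open>M\<close>, where the support is given.\<close>
      using exists_Sigma_and_not_Pi_transfer[OF M' M bs as eq[symmetric] \<open>l \<noteq> o0\<close> theta(1,2) _ _ ds]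
      by blast
    then show False
      using sup[OF \<open>g \<in> G\<close>] by (auto simp: models_def holds_Alls)
  qed
  ultimately show ?thesis
    using Phi theta by (simp add: supports_def)
qed

end
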